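(* Let $m_n^{(irr)} := |\{(\pi,\rho)\in NC(n)^2 \mid M_{\pi,\rho} \text{ is irreducible}\}|$ for $n\in\mathbb{N}=\{1,2,\dots\}$, and let $f_{\mathrm{irr}}(z) := \sum_{n=1}^\infty m_n^{(irr)} z^{2n}$. Let $\xi,\eta$ be (classically) independent real random variables on a probability space $(\Omega,\mathcal{F},P)$, each having the centred semicircular distribution of variance $1$, i.e. the distribution $\frac{1}{2\pi}\sqrt{4-t^2}\,dt$ on $[-2,2]$. Then $f_{\mathrm{irr}}$ is the $R$-transform of the product $\xi\eta$; that is, the free cumulants of $\xi\eta$ are $$\kappa_{2n-1}(\xi\eta)=0 \quad\text{and}\quad \kappa_{2n}(\xi\eta)=m_n^{(irr)}\qquad\text{for all } n\in\mathbb{N}.$$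
   Context: $NC(n)$ is the set of non-crossing partitions of $\{1,\dots,n\}$: partitions for which there are no two distinct blocks $V,W$ and $a<b<c<d$ with $a,c\in V$ and $b,d\in W$. For $\pi\in NC(n)$, $P_\pi$ denotes the permutation of $\{1,\dots,n\}$ whose orbits are the blocks of $\pi$ and which performs an increasing cycle on each block: for a block $\{i_1<\dots<i_k\}$, $P_\pi(i_1)=i_2,\dots,P_\pi(i_{k-1})=i_k$, $P_\pi(i_k)=i_1$. For $\pi,\rho\in NC(n)$, the meandric system $M_{\pi,\rho}$ is the permutation of $\{1,\dots,2n\}$ given by $M_{\pi,\rho}(2i-1)=2P_\pi^{-1}(i)$ and $M_{\pi,\rho}(2i)=2P_\rho(i)-1$ for $1\le i\le n$. It is reducible if there is a proper subinterval $J=\{a,a+1,\dots,b\}\subset\{1,\dots,2n\}$ (with $1\le a\le b\le 2n$ and $b-a<2n-1$) which is invariant under $M_{\pi,\rho}$; it is irreducible if it is not reducible. For a linear functional $\mu:\mathbb{C}[X]\to\mathbb{C}$ with $\mu(1)=1$, the free cumulants $(\kappa_n(\mu))_{n\ge1}$ are the complex numbers uniquely determined by $$\mu(X^n)=\sum_{\pi\in NC(n)}\ \prod_{V\in\pi}\kappa_{|V|}(\mu),\qquad n\in\mathbb{N},$$ the product being over the blocks $V$ of $\pi$. The $R$-transform of $\mu$ is the (formal) power series $R_\mu(z)=\sum_{n\ge1}\kappa_n(\mu)z^n$. For a real random variable $\zeta$ with finite moments of all orders, its distribution is the functional $\mu$ with $\mu(X^n)=\int\zeta^n\,dP$ for $n\geq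 0$, and the free cumulants $\kappa_n(\zeta)$ and $R$-transform of $\zeta$ are those of $\mu$. *)

theory Defs
  imports
    "HOL-Probability.Probability"
    "HOL-Computational_Algebra.Polynomial"
    "HOL-Computational_Algebra.Formal_Power_Series"
begin

definition non_crossing :: "nat set set \<Rightarrow> bool" where
  "non_crossing \<pi> \<longleftrightarrow>
     \<not> (\<exists>V\<in>\<pi>. \<exists>W\<in>\<pi>. V \<noteq> W \<and>
          (\<exists>a b c d. a < b \<and> b < c \<and> c < d \<and> a \<in> V \<and> c \<in> V \<and> b \<in> W \<and> d \<in> W))"

definition NC :: "nat \<Rightarrow> nat set set set" where
  "NC n = {\<pi>. partition_on {1..n} \<pi> \<and> non_crossing \<pi>}"

(* As usual with "permutes", a permutation of {1..n} is a function
   on nat that is the identity outside {1..n}. *)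

definition block_cycle :: "nat set set \<Rightarrow> nat \<Rightarrow> nat" where
  "block_cycle \<pi> i =
     (if i \<in> \<Union>\<pi>
      then (let V = (THE V. V \<in> \<pi> \<and> i \<in> V)
            in if i = Max V then Min V else Min {j \<in> V. i < j})
      else i)"

definition meandric_system :: "nat \<Rightarrow> nat set set \<Rightarrow> nat set set \<Rightarrow> nat \<Rightarrow> nat" where
  "meandric_system n \<pi> \<rho> k =
     (if k \<in> {1..2 * n}
      then (if odd k then 2 * inv (block_cycle \<pi>) ((k + 1) div 2)
            else 2 * block_cycle \<rho> (k div 2) - 1)
      else k)"

definition reducible_meandric :: "nat \<Rightarrow> nat set set \<Rightarrow> nat set set \<Rightarrow> bool" where
  "reducible_meandric n \<pi> \<rho> \<longleftrightarrow>
     (\<exists>a b. 1 \<le> a \<and> a \<le> b \<and> b \<le> 2 * n \<and> b - a < 2 * n - 1 \<and>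
            meandric_system n \<pi> \<rho> ` {a..b} = {a..b})"

definition m_irr :: "nat \<Rightarrow> nat" where
  "m_irr n = card {(\<pi>, \<rho>). \<pi> \<in> NC n \<and> \<rho> \<in> NC n \<and> \<not> reducible_meandric n \<pi> \<rho>}"

(* The sum of m_irr n * z ^ (2 * n) over n \<ge> 1. *)
definition f_irr :: "complex fps" where
  "f_irr = Abs_fps (\<lambda>k. if k = 0 \<or> odd k then 0 else of_nat (m_irr (k div 2)))"

(* The moment-cumulant formula only constrains indices n \<ge> 1; the value at index 0 is fixed
   to 0 so that the sequence is unique. *)
definition free_cumulant :: "(complex poly \<Rightarrow> complex) \<Rightarrow> nat \<Rightarrow> complex" where
  "free_cumulant \<mu> =
     (THE \<kappa>. \<kappa> 0 = 0 \<and>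
        (\<forall>n\<ge>1. \<mu> (monom 1 n) = (\<Sum>\<pi>\<in>NC n. \<Prod>V\<in>\<pi>. \<kappa> (card V))))"

definition R_transform :: "(complex poly \<Rightarrow> complex) \<Rightarrow> complex fps" where
  "R_transform \<mu> = Abs_fps (\<lambda>n. if n = 0 then 0 else free_cumulant \<mu> n)"

(* The complex-linear functional on polynomials that maps X ^ n to the n-th moment; it is
   meaningful when all moments are finite. *)
definition moment_functional :: "'a measure \<Rightarrow> ('a \<Rightarrow> real) \<Rightarrow> complex poly \<Rightarrow> complex" where
  "moment_functional M \<zeta> p =
     (\<Sum>i\<le>degree p. coeff p i * complex_of_real (integral\<^sup>L M (\<lambda>\<omega>. \<zeta> \<omega> ^ i)))"

definition semicircle_density :: "real \<Rightarrow> real" where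
  "semicircle_density t = indicator {-2..2} t * (sqrt (4 - t\<^sup>2) / (2 * pi))"

lemma moment_functional_monom:
  "moment_functional M \<zeta> (monom 1 n) = complex_of_real (integral\<^sup>L M (\<lambda>\<omega>. \<zeta> \<omega> ^ n))"
proof -
  have "moment_functional M \<zeta> (monom 1 n) =
        (\<Sum>i\<le>n. if i = n then complex_of_real (integral\<^sup>L M (\<lambda>\<omega>. \<zeta> \<omega> ^ i)) else 0)"
    unfolding moment_functional_def by (intro sum.cong) (auto simp: degree_monom_eq)
  then show ?thesis by simp
qed

lemma linear_moment_functional:
  "Vector_Spaces.linear smult (*) (moment_functional M \<zeta>)"
proof -
  let ?m = "\<lambda>i. complex_of_real (integral\<^sup>L M (\<lambda>\<omega>. \<zeta> \<omega> ^ i))"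
  have ext: "moment_functional M \<zeta> p = (\<Sum>i\<le>d. coeff p i * ?m i)" if "degree p \<le> d" for p d
    unfolding moment_functional_def using that
    by (intro sum.mono_neutral_left) (auto simp: coeff_eq_0)
  have add: "moment_functional M \<zeta> (p + q) = moment_functional M \<zeta> p + moment_functional M \<zeta> q"
    for p q
    using ext[of p "max (degree p) (degree q)"] ext[of q "max (degree p) (degree q)"]
      ext[of "p + q" "max (degree p) (degree q)"] degree_add_le_max[of p q]
    by (simp add: sum.distrib algebra_simps)
  have scale: "moment_functional M \<zeta> (smult c p) = c * moment_functional M \<zeta> p" for c p
    using ext[of p "degree p"] ext[of "smult c p" "degree p"] degree_smult_le[of c p]
    by (simp add: sum_distrib_left algebra_simps)
  show ?thesis
    by unfold_locales (auto simp: add scale smult_add_right smult_add_left algebra_simps)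
qed

lemma finite_NC: "finite (NC n)"
  by (rule finite_subset[of _ "Pow (Pow {1..n})"]) (auto simp: NC_def partition_on_def)

lemma one_block_in_NC: "n \<ge> 1 \<Longrightarrow> {{1..n}} \<in> NC n"
  by (auto simp: NC_def partition_on_def non_crossing_def disjoint_def)

lemma card_block_less:
  assumes "\<pi> \<in> NC n" "\<pi> \<noteq> {{1..n}}" "V \<in> \<pi>"
  shows "card V < n"
proof -
  have p: "partition_on {1..n} \<pi>" using assms(1) by (simp add: NC_def)
  have sub: "V \<subseteq> {1..n}" using p assms(3) by (auto simp: partition_on_def)
  have "V \<noteq> {1..n}"
  proof
    assume V: "V = {1..n}"
    have "W = V" if "W \<in> \<pi>" for W
    proof (rule ccontr)
      assume "W \<noteq> V"
      then have "W \<inter> V = {}" using p that assms(3) by (auto simp: partition_on_def disjoint_def)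
      moreover have "W \<subseteq> V" "W \<noteq> {}" using p that V by (auto simp: partition_on_def)
      ultimately show False by auto
    qed
    then have "\<pi> = {{1..n}}" using assms(3) V by blast
    with assms(2) show False ..
  qed
  with sub have "V \<subset> {1..n}" by blast
  from psubset_card_mono[OF _ this] show ?thesis by simp
qed

theorem free_cumulants_ex1:
  fixes \<mu> :: "complex poly \<Rightarrow> complex"
  shows "\<exists>!\<kappa>. \<kappa> 0 = 0 \<and>
           (\<forall>n\<ge>1. \<mu> (monom 1 n) = (\<Sum>\<pi>\<in>NC n. \<Prod>V\<in>\<pi>. \<kappa> (card V)))"
proof -
  define F :: "(nat \<Rightarrow> complex) \<Rightarrow> nat \<Rightarrow> complex" where
    "F \<kappa> n = (if n = 0 then 0 else
        \<mu> (monom 1 n) - (\<Sum>\<pi>\<in>NC n - {{{1..n}}}. \<Prod>V\<in>\<pi>. \<kappa> (card V)))" for \<kappa> n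
  have cong: "F f n = F g n" if "\<And>m. m < n \<Longrightarrow> f m = g m" for f g n
    unfolding F_def
    by (auto intro!: sum.cong prod.cong that card_block_less)
  have split: "(\<Sum>\<pi>\<in>NC n. \<Prod>V\<in>\<pi>. \<kappa> (card V)) =
      \<kappa> n + (\<Sum>\<pi>\<in>NC n - {{{1..n}}}. \<Prod>V\<in>\<pi>. \<kappa> (card V))"
    if "n \<ge> 1" for n and \<kappa> :: "nat \<Rightarrow> complex"
    by (subst sum.remove[OF finite_NC one_block_in_NC[OF that]]) simp
  have iff: "(\<kappa> 0 = 0 \<and> (\<forall>n\<ge>1. \<mu> (monom 1 n) = (\<Sum>\<pi>\<in>NC n. \<Prod>V\<in>\<pi>. \<kappa> (card V))))
      \<longleftrightarrow> (\<forall>n. \<kappa> n = F \<kappa> n)" (is "?L \<longleftrightarrow> ?R") for \<kappa>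
  proof
    assume ?L
    then show ?R using split[of _ \<kappa>] by (auto simp: F_def)
  next
    assume R: ?R
    show ?L
    proof (intro conjI allI impI)
      show "\<kappa> 0 = 0" using R[rule_format, of 0] by (simp add: F_def)
      fix n :: nat assume n: "n \<ge> 1"
      then show "\<mu> (monom 1 n) = (\<Sum>\<pi>\<in>NC n. \<Prod>V\<in>\<pi>. \<kappa> (card V))"
        using R[rule_format, of n] split[OF n, of \<kappa>] by (simp add: F_def)
    qed
  qed
  have "\<exists>f. \<forall>n. f n = F f n"
  proof (rule dependent_wf_choice[OF wf_less_than, where P = "\<lambda>f n r. r = F f n"])
    fix f g :: "nat \<Rightarrow> complex" and n r
    assume "\<And>m. (m, n) \<in> less_than \<Longrightarrow> f m = g m"
    then have "F f n = F g n" by (intro cong) simp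
    then show "(r = F f n) = (r = F g n)" by simp
  qed simp
  moreover have "f = g" if "\<forall>n. f n = F f n" "\<forall>n. g n = F g n" for f g
  proof
    fix n show "f n = g n"
    proof (induction n rule: less_induct)
      case (less n)
      have "F f n = F g n" by (rule cong) (rule less)
      with that show ?case by simp
    qed
  qed
  ultimately show ?thesis unfolding iff by blast
qed

lemma block_cycle_permutes:
  assumes "partition_on {1..n} \<pi>"
  shows "block_cycle \<pi> permutes {1..n}"
proof -
  have U: "\<Union>\<pi> = {1..n}" using assms by (simp add: partition_on_def)
  have uniq: "(THE V. V \<in> \<pi> \<and> i \<in> V) = V" if "V \<in> \<pi>" "i \<in> V" for i V
    using assms that by (intro the_equality) (auto simp: partition_on_def disjoint_def)
  have fin: "finite V" if "V \<in> \<pi>" for V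
    by (rule finite_subset[of _ "{1..n}"]) (use U that in auto)
  have bc: "block_cycle \<pi> i = (if i = Max V then Min V else Min {j \<in> V. i < j})"
    if "V \<in> \<pi>" "i \<in> V" for i V
    using that uniq[OF that] by (auto simp: block_cycle_def)
  have next_in: "Min {j \<in> V. i < j} \<in> {j \<in> V. i < j}"
    if "V \<in> \<pi>" "i \<in> V" "i \<noteq> Max V" for i V
  proof (rule Min_in)
    show "finite {j \<in> V. i < j}" using fin[OF that(1)] by simp
    have "Max V \<in> V" "i \<le> Max V" using fin[OF that(1)] that(2) by (auto intro: Max_in)
    then show "{j \<in> V. i < j} \<noteq> {}" using that(3) by force
  qed
  have inV: "block_cycle \<pi> i \<in> V" if "V \<in> \<pi>" "i \<in> V" for i V
    using next_in[OF that] bc[OF that] fin[OF that(1)] that(2) by (auto intro: Min_in)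
  have le: "False" if V: "V \<in> \<pi>" "i \<in> V" "j \<in> V" "i < j"
    and eq: "block_cycle \<pi> i = block_cycle \<pi> j" for i j V
  proof -
    have iM: "i \<noteq> Max V" using V(4) Max_ge[OF fin[OF V(1)] V(3)] by auto
    then have n1: "block_cycle \<pi> i > i" "block_cycle \<pi> i \<le> j"
      using next_in[OF V(1,2)] bc[OF V(1,2)] V fin[OF V(1)] by auto
    show False
    proof (cases "j = Max V")
      case True
      then have "block_cycle \<pi> j \<le> i" using bc[OF V(1,3)] fin[OF V(1)] V by auto
      with n1 eq show False by simp
    next
      case False
      then have "block_cycle \<pi> j > j" using next_in[OF V(1,3)] bc[OF V(1,3)] by auto
      with n1 eq show False by simp
    qed
  qed
  have "inj_on (block_cycle \<pi>) {1..n}"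
  proof (rule inj_onI)
    fix i j assume ij: "i \<in> {1..n}" "j \<in> {1..n}" "block_cycle \<pi> i = block_cycle \<pi> j"
    obtain V W where VW: "V \<in> \<pi>" "i \<in> V" "W \<in> \<pi>" "j \<in> W" using ij U by blast
    have "block_cycle \<pi> i \<in> V" "block_cycle \<pi> i \<in> W"
      using inV[OF VW(1,2)] inV[OF VW(3,4)] ij(3) by simp_all
    from uniq[OF VW(1) this(1)] uniq[OF VW(3) this(2)] have "V = W" by simp
    then show "i = j" using le[OF VW(1), of i j] le[OF VW(1), of j i] VW ij(3)
      by (cases i j rule: linorder_cases) auto
  qed
  moreover have "block_cycle \<pi> ` {1..n} \<subseteq> {1..n}" using inV U by blast
  ultimately have "bij_betw (block_cycle \<pi>) {1..n} {1..n}"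
    by (simp add: bij_betw_def endo_inj_surj)
  moreover have "block_cycle \<pi> i = i" if "i \<notin> {1..n}" for i
    using that unfolding block_cycle_def U by (rule if_not_P)
  ultimately show ?thesis by (rule bij_imp_permutes)
qed

end

theory Submission
  imports Defs
begin

text \<open>
  Drawing the arches of a meandric system above and below the line turns the pair \<open>(\<pi>, \<rho>)\<close> into a
  pair \<open>(u, l)\<close> of non-crossing pairings of \<open>{1..2n}\<close>, and invariance of an interval means that it
  is a union of arches of \<open>u\<close> and of \<open>l\<close>. For every such pair there is exactly one non-crossing
  partition \<open>\<sigma>\<close> coarser than \<open>u\<close> and \<open>l\<close> whose blocks carry irreducible pairs, because every
  non-crossing partition has a block that is an interval. Hence, if \<open>\<kappa> k\<close> counts the irreducible pairs
  on \<open>k\<close> points, then \<open>\<Sum>\<sigma>\<in>NC k. \<Prod>V\<in>\<sigma>. \<kappa> (card V)\<close> counts all pairs. That number is the square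
  of the number of non-crossing pairings, which is the \<open>k\<close>-th semicircular moment, so by
  independence it is the \<open>k\<close>-th moment of \<open>\<xi>\<eta>\<close>.
\<close>

subsection \<open>Non-crossing pairings and irreducible pairs\<close>

text \<open>The blocks of \<open>\<sigma>\<close> are arbitrary finite sets of naturals, so
  irreducibility must make sense on such sets: intervals are taken relative to the carrier, and
  increasing bijections compare the counts with those on \<open>{1..k}\<close>. Uniqueness of
  \<open>\<sigma>\<close>: let \<open>\<tau>\<close> be any non-crossing partition coarser than both
  pairings. Its trace on a block \<open>V\<close> of \<open>\<sigma>\<close> is non-crossing, so
  some trace block is an interval of \<open>V\<close>. This interval is a union of arcs of both
  pairings, and irreducibility on \<open>V\<close> forces it to be all of \<open>V\<close>. Hence
  \<open>\<sigma>\<close> refines \<open>\<tau>\<close>; two decompositions refine each other. No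
  power series is inverted: the free cumulants are the only solution of the moment-cumulant
  equations, so it is enough that the counts solve them. The Catalan numbers enter without a closed
  formula: the pairing counts and the even moments satisfy the same first-order recurrence, obtained
  from the quadratic equation of the generating function on one side and from integration by parts
  on the other.\<close>

definition nc_pairings :: "nat set \<Rightarrow> nat set set set" where
  "nc_pairings A = {u. partition_on A u \<and> non_crossing u \<and> (\<forall>p\<in>u. card p = 2)}"

definition subordinate :: "'a set set \<Rightarrow> 'a set set \<Rightarrow> bool" where
  "subordinate u \<sigma> \<longleftrightarrow> (\<forall>p\<in>u. \<exists>V\<in>\<sigma>. p \<subseteq> V)"

definition restr :: "'a set set \<Rightarrow> 'a set \<Rightarrow> 'a set set" where
  "restr u V = {p \<in> u. p \<subseteq> V}"

definition saturated :: "'a set set \<Rightarrow> 'a set \<Rightarrow> bool" where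
  "saturated u J \<longleftrightarrow> (\<forall>p\<in>u. p \<subseteq> J \<or> p \<inter> J = {})"

text \<open>Convexity relative to \<open>A\<close>: gaps of \<open>A\<close> do not count. For a
  block \<open>V\<close> with holes this is the notion preserved by increasing bijections onto
  \<open>{1..card V}\<close>.\<close>

definition interval_in :: "nat set \<Rightarrow> nat set \<Rightarrow> bool" where
  "interval_in A J \<longleftrightarrow> J \<subseteq> A \<and> (\<forall>x\<in>J. \<forall>z\<in>J. \<forall>y\<in>A. x < y \<and> y < z \<longrightarrow> y \<in> J)"

definition irreducible_pair :: "nat set \<Rightarrow> nat set set \<Rightarrow> nat set set \<Rightarrow> bool" where
  "irreducible_pair A u l \<longleftrightarrow>
     \<not> (\<exists>J. J \<noteq> {} \<and> J \<noteq> A \<and> interval_in A J \<and> saturated u J \<and> saturated l J)"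

definition irr_pairs :: "nat set \<Rightarrow> (nat set set \<times> nat set set) set" where
  "irr_pairs A = {(u, l). u \<in> nc_pairings A \<and> l \<in> nc_pairings A \<and> irreducible_pair A u l}"

section \<open>Elementary facts on partitions and pairings\<close>

lemma non_crossingD:
  assumes "non_crossing \<pi>" "V \<in> \<pi>" "W \<in> \<pi>" "a < b" "b < c" "c < d"
    "a \<in> V" "c \<in> V" "b \<in> W" "d \<in> W"
  shows "V = W"
  using assms unfolding non_crossing_def by blast

lemma non_crossingI:
  assumes "\<And>V W a b c d. \<lbrakk>V \<in> \<pi>; W \<in> \<pi>; V \<noteq> W; a < b; b < c; c < d;
    a \<in> V; c \<in> V; b \<in> W; d \<in> W\<rbrakk> \<Longrightarrow> False"
  shows "non_crossing \<pi>"
  using assms unfolding non_crossing_def by blast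

lemma partition_on_unique:
  assumes "partition_on A u" "p \<in> u" "q \<in> u" "x \<in> p" "x \<in> q"
  shows "p = q"
  using assms by (auto simp: partition_on_def disjoint_def)

lemma partition_on_mem:
  assumes "partition_on A u" "x \<in> A"
  obtains p where "p \<in> u" "x \<in> p"
  using assms by (auto simp: partition_on_def)

text \<open>Antisymmetry of refinement: going from \<open>V\<close> up to \<open>W\<close> and back
  up to \<open>V'\<close> stays in one block, because \<open>V\<close> is nonempty and contained in
  \<open>V'\<close>.\<close>

lemma partition_on_eqI:
  assumes a: "partition_on A \<sigma>" "partition_on A \<tau>"
    and f: "\<And>V. V \<in> \<sigma> \<Longrightarrow> \<exists>W\<in>\<tau>. V \<subseteq> W" and g: "\<And>V. V \<in> \<tau> \<Longrightarrow> \<exists>W\<in>\<sigma>. V \<subseteq> W"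
  shows "\<sigma> = \<tau>"
proof -
  have *: "\<sigma> \<subseteq> \<tau>"
    if a: "partition_on A \<sigma>" "partition_on A \<tau>"
      and f: "\<And>V. V \<in> \<sigma> \<Longrightarrow> \<exists>W\<in>\<tau>. V \<subseteq> W" and g: "\<And>V. V \<in> \<tau> \<Longrightarrow> \<exists>W\<in>\<sigma>. V \<subseteq> W" for \<sigma> \<tau>
  proof
    fix V assume V: "V \<in> \<sigma>"
    obtain W where W: "W \<in> \<tau>" "V \<subseteq> W" using f V by blast
    obtain V' where V': "V' \<in> \<sigma>" "W \<subseteq> V'" using g W by blast
    obtain x where "x \<in> V" using a(1) V by (fastforce simp: partition_on_def)
    then have "V = V'" using partition_on_unique[OF a(1) V V'(1)] W V' by auto
    then show "V \<in> \<tau>" using W V' by auto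
  qed
  show ?thesis using *[OF a f g] *[OF a(2,1) g f] by blast
qed

lemma nc_pairingsD:
  assumes "u \<in> nc_pairings A"
  shows "partition_on A u" "non_crossing u" "\<And>p. p \<in> u \<Longrightarrow> card p = 2"
  using assms by (auto simp: nc_pairings_def)

lemma finite_nc_pairings: "finite A \<Longrightarrow> finite (nc_pairings A)"
  by (rule finite_subset[of _ "Pow (Pow A)"]) (auto simp: nc_pairings_def partition_on_def)

lemma finite_irr_pairs: "finite A \<Longrightarrow> finite (irr_pairs A)"
  by (rule finite_subset[of _ "nc_pairings A \<times> nc_pairings A"])
    (auto simp: irr_pairs_def finite_nc_pairings)

lemma nc_pairings_empty: "nc_pairings {} = {{}}"
  by (auto simp: nc_pairings_def partition_on_empty non_crossing_def)

lemma nc_pairing_even_card: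
  assumes "finite A" "u \<in> nc_pairings A"
  shows "even (card A)"
proof -
  note u = nc_pairingsD[OF assms(2)]
  have "finite u" using assms(1) u(1) by (rule finite_elements)
  have "card A = card (\<Union>u)" using u(1) by (simp add: partition_on_def)
  also have "\<dots> = (\<Sum>p\<in>u. card p)"
    using u(1,3) assms(1)
    by (intro card_Union_disjoint) (auto simp: partition_on_def intro: finite_subset)
  also have "\<dots> = (\<Sum>p\<in>u. 2)" using u(3) by (intro sum.cong) auto
  also have "\<dots> = 2 * card u" by simp
  finally show ?thesis by simp
qed

text \<open>\<open>\<sigma>\<close> is a disjoint family that may contain the empty set. This covers
  the cuts along an arc, where the region inside or outside the arc can be empty.\<close>

lemma restr_nc_pairing:
  assumes "u \<in> nc_pairings A" "subordinate u \<sigma>" "disjoint \<sigma>" "V \<in> \<sigma>" "V \<subseteq> A"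
  shows "restr u V \<in> nc_pairings V"
proof -
  note u = nc_pairingsD[OF assms(1)]
  have "V \<subseteq> \<Union>(restr u V)"
  proof
    fix x assume x: "x \<in> V"
    then obtain p where p: "p \<in> u" "x \<in> p" using partition_on_mem[OF u(1)] assms(5) by blast
    then obtain W where W: "W \<in> \<sigma>" "p \<subseteq> W" using assms(2) by (auto simp: subordinate_def)
    then have "W = V" using assms(3,4) x p by (auto simp: disjoint_def)
    then show "x \<in> \<Union>(restr u V)" using p W by (auto simp: restr_def)
  qed
  then have "partition_on V (restr u V)"
    using u(1) by (auto simp: partition_on_def disjoint_def restr_def)
  moreover have "non_crossing (restr u V)"
    using u(2) by (auto simp: non_crossing_def restr_def)
  ultimately show ?thesis using u(3) by (auto simp: nc_pairings_def restr_def)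
qed

text \<open>Inverse to restriction. Two crossing arcs taken from different blocks would make the
  blocks themselves cross, and arcs from the same block do not cross by assumption.\<close>

lemma Union_nc_pairings:
  assumes "disjoint \<sigma>" "non_crossing \<sigma>" "\<And>V. V \<in> \<sigma> \<Longrightarrow> h V \<in> nc_pairings V"
  shows "(\<Union>V\<in>\<sigma>. h V) \<in> nc_pairings (\<Union>\<sigma>)"
proof -
  note h = nc_pairingsD[OF assms(3)]
  have sub: "p \<subseteq> V" if "V \<in> \<sigma>" "p \<in> h V" for p V
    using h(1)[OF that(1)] that(2) by (auto simp: partition_on_def)
  have "partition_on (\<Union>\<sigma>) (\<Union>V\<in>\<sigma>. h V)"
  proof (rule partition_onI)
    show "\<Union> (\<Union>V\<in>\<sigma>. h V) = \<Union> \<sigma>" using h(1) by (fastforce simp: partition_on_def)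
    show "{} \<notin> (\<Union>V\<in>\<sigma>. h V)" using h(1) by (auto simp: partition_on_def)
    fix p q assume pq: "p \<in> (\<Union>V\<in>\<sigma>. h V)" "q \<in> (\<Union>V\<in>\<sigma>. h V)" "p \<noteq> q"
    then obtain V W where VW: "V \<in> \<sigma>" "p \<in> h V" "W \<in> \<sigma>" "q \<in> h W" by blast
    show "disjnt p q"
    proof (cases "V = W")
      case True
      then show ?thesis using partition_on_unique[OF h(1)[OF VW(1)]] VW pq(3)
        by (auto simp: disjnt_iff)
    next
      case False
      then have "V \<inter> W = {}" using assms(1) VW by (auto simp: disjoint_def)
      then show ?thesis using sub VW by (fastforce simp: disjnt_iff)
    qed
  qed
  moreover have "non_crossing (\<Union>V\<in>\<sigma>. h V)"
  proof (rule non_crossingI)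
    fix p q a b c d
    assume pq: "p \<in> (\<Union>V\<in>\<sigma>. h V)" "q \<in> (\<Union>V\<in>\<sigma>. h V)" "p \<noteq> q"
      and o: "a < b" "b < c" "c < d" and m: "a \<in> p" "c \<in> p" "b \<in> q" "d \<in> q"
    then obtain V W where VW: "V \<in> \<sigma>" "p \<in> h V" "W \<in> \<sigma>" "q \<in> h W" by blast
    then have "p \<subseteq> V" "q \<subseteq> W" using sub by auto
    then have "V = W" using m by (intro non_crossingD[OF assms(2) VW(1,3) o]) auto
    then show False using non_crossingD[OF h(2)[OF VW(1)] _ _ o m] VW pq(3) by auto
  qed
  ultimately show ?thesis using h(3) by (auto simp: nc_pairings_def)
qed

lemma subordinate_Union:
  assumes "\<And>V. V \<in> \<sigma> \<Longrightarrow> h V \<in> nc_pairings V"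
  shows "subordinate (\<Union>V\<in>\<sigma>. h V) \<sigma>"
  unfolding subordinate_def
proof
  fix p assume "p \<in> (\<Union>V\<in>\<sigma>. h V)"
  then obtain V where V: "V \<in> \<sigma>" "p \<in> h V" by blast
  have "partition_on V (h V)" using assms[OF V(1)] by (rule nc_pairingsD)
  then have "p \<subseteq> V" using V(2) by (auto simp: partition_on_def)
  then show "\<exists>V\<in>\<sigma>. p \<subseteq> V" using V(1) by blast
qed

lemma restr_Union:
  assumes "disjoint \<sigma>" "\<And>V. V \<in> \<sigma> \<Longrightarrow> h V \<in> nc_pairings V" "V \<in> \<sigma>"
  shows "restr (\<Union>V\<in>\<sigma>. h V) V = h V"
proof -
  note h = nc_pairingsD[OF assms(2)]
  have sub: "p \<subseteq> W" "p \<noteq> {}" if "W \<in> \<sigma>" "p \<in> h W" for p W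
    using h(1)[OF that(1)] that(2) by (auto simp: partition_on_def)
  have "W = V" if "p \<in> h W" "W \<in> \<sigma>" "p \<subseteq> V" for p W
    using sub[OF that(2,1)] that assms(1,3) by (fastforce simp: disjoint_def)
  then show ?thesis using sub assms(3) by (fastforce simp: restr_def)
qed

lemma Union_restr: "subordinate u \<sigma> \<Longrightarrow> (\<Union>V\<in>\<sigma>. restr u V) = u"
  by (auto simp: restr_def subordinate_def)

subsection \<open>Decomposition into irreducible pairs\<close>

text \<open>Take a block \<open>W\<close> of least span \<open>Max W - Min W\<close>. A block
  through a gap of \<open>W\<close> cannot leave the range between \<open>Min W\<close> and
  \<open>Max W\<close> without crossing \<open>W\<close>, so it would have smaller span.\<close>

lemma ex_interval_block:
  assumes "finite A" "partition_on A \<sigma>" "non_crossing \<sigma>" "\<sigma> \<noteq> {}"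
  shows "\<exists>W\<in>\<sigma>. interval_in A W"
proof -
  have sub: "W \<subseteq> A" "W \<noteq> {}" "finite W" if "W \<in> \<sigma>" for W
    using assms(1,2) that finite_subset[of W A] by (auto simp: partition_on_def)
  define sp where "sp W = Max W - Min W" for W :: "nat set"
  obtain W where W: "W \<in> \<sigma>" "\<And>W'. W' \<in> \<sigma> \<Longrightarrow> sp W \<le> sp W'"
    using ex_has_least_nat[of "\<lambda>W. W \<in> \<sigma>" _ sp] assms(4) by blast
  have mm: "Min W \<in> W" "Max W \<in> W" using sub[OF W(1)] by auto
  have "y \<in> W" if y: "x \<in> W" "z \<in> W" "y \<in> A" "x < y" "y < z" for x y z
  proof (rule ccontr)
    assume nW: "y \<notin> W"
    obtain W' where W': "W' \<in> \<sigma>" "y \<in> W'" using partition_on_mem[OF assms(2) y(3)] by blast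
    have ne: "W' \<noteq> W" using nW W' by auto
    have lt: "Min W < y" "y < Max W"
      using Min_le[OF sub(3)[OF W(1)] y(1)] Max_ge[OF sub(3)[OF W(1)] y(2)] y(4,5) by auto
    have in1: "Min W < t \<and> t < Max W" if t: "t \<in> W'" for t
    proof (rule ccontr)
      assume "\<not> (Min W < t \<and> t < Max W)"
      moreover have "t \<noteq> Min W" "t \<noteq> Max W"
        using partition_on_unique[OF assms(2) W'(1) W(1) t] mm ne by auto
      ultimately have "t < Min W \<or> Max W < t" by auto
      then show False
        using non_crossingD[OF assms(3) W'(1) W(1), of t "Min W" y "Max W"]
          non_crossingD[OF assms(3) W(1) W'(1), of "Min W" y "Max W" t] t W' mm lt ne by auto
    qed
    have "Min W' \<in> W'" "Max W' \<in> W'" using sub[OF W'(1)] by auto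
    from in1[OF this(1)] in1[OF this(2)] have "sp W' < sp W"
      unfolding sp_def by linarith
    with W(2)[OF W'(1)] show False by simp
  qed
  then show ?thesis using W(1) sub(1) by (auto simp: interval_in_def)
qed

text \<open>The nonempty sets \<open>V \<inter> W\<close> with \<open>W\<close> in
  \<open>\<tau>\<close> form a non-crossing partition of \<open>V\<close>. Each of them is saturated
  for both pairings, since every arc lies in a single block of \<open>\<tau>\<close>; one that is an
  interval of \<open>V\<close> must be \<open>V\<close> itself.\<close>

lemma irreducible_subordinate_block:
  assumes "finite A" "partition_on A \<sigma>" "partition_on A \<tau>" "non_crossing \<tau>"
    and "subordinate u \<tau>" "subordinate l \<tau>" "V \<in> \<sigma>"
    and irr: "irreducible_pair V (restr u V) (restr l V)"
  shows "\<exists>W\<in>\<tau>. V \<subseteq> W"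
proof -
  have V: "V \<subseteq> A" "V \<noteq> {}" using assms(2,7) by (auto simp: partition_on_def)
  let ?P = "(\<inter>) V ` \<tau> - {{}}"
  have P: "partition_on V ?P"
    using partition_on_restrict[OF assms(3), of V] V(1) by (simp add: Int_absorb2)
  moreover have "non_crossing ?P"
    using assms(4) by (fastforce simp: non_crossing_def)
  moreover have "?P \<noteq> {}" using P V(2) by (auto simp: partition_on_def)
  ultimately obtain J where J: "J \<in> ?P" "interval_in V J"
    using ex_interval_block[of V ?P] V(1) assms(1) finite_subset by blast
  then obtain W where W: "W \<in> \<tau>" "J = V \<inter> W" "J \<noteq> {}" by auto
  have "saturated (restr x V) J" if x: "subordinate x \<tau>" for x
    unfolding saturated_def
  proof
    fix p assume p: "p \<in> restr x V"
    then obtain W' where W': "W' \<in> \<tau>" "p \<subseteq> W'" using x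
      unfolding restr_def subordinate_def by blast
    show "p \<subseteq> J \<or> p \<inter> J = {}"
    proof (cases "W' = W")
      case True then show ?thesis using p W W' by (auto simp: restr_def)
    next
      case False
      then have "W \<inter> W' = {}" using partition_on_unique[OF assms(3) W(1) W'(1)] by auto
      then show ?thesis using W(2) W'(2) by auto
    qed
  qed
  note sat = this[OF assms(5)] this[OF assms(6)]
  have "J = V" using irr J(2) W(3) sat unfolding irreducible_pair_def by metis
  then show ?thesis using W by auto
qed

lemma irreducible_decomposition_unique:
  assumes "finite A" "partition_on A \<sigma>" "partition_on A \<tau>" "non_crossing \<sigma>" "non_crossing \<tau>"
    and "subordinate u \<sigma>" "subordinate l \<sigma>" "subordinate u \<tau>" "subordinate l \<tau>"
    and "\<And>V. V \<in> \<sigma> \<Longrightarrow> irreducible_pair V (restr u V) (restr l V)"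
    and "\<And>V. V \<in> \<tau> \<Longrightarrow> irreducible_pair V (restr u V) (restr l V)"
  shows "\<sigma> = \<tau>"
proof -
  have 1: "\<exists>W\<in>\<tau>. V \<subseteq> W" if "V \<in> \<sigma>" for V
    by (rule irreducible_subordinate_block[of A \<sigma> \<tau> u l]) (use assms that in auto)
  have 2: "\<exists>W\<in>\<sigma>. V \<subseteq> W" if "V \<in> \<tau>" for V
    by (rule irreducible_subordinate_block[of A \<tau> \<sigma> u l]) (use assms that in auto)
  show ?thesis using assms(2,3) 1 2 by (rule partition_on_eqI)
qed

text \<open>Cutting an interval \<open>J\<close> out of \<open>V\<close> creates no crossing: in an
  alternating quadruple of points of \<open>J\<close> and \<open>V - J\<close>, some point of
  \<open>V - J\<close> would lie between two points of \<open>J\<close>.\<close>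

lemma split_block:
  assumes "partition_on A \<sigma>" "non_crossing \<sigma>" "V \<in> \<sigma>" "J \<noteq> {}" "J \<noteq> V" "interval_in V J"
  defines "\<sigma>' \<equiv> insert J (insert (V - J) (\<sigma> - {V}))"
  shows "partition_on A \<sigma>'" "non_crossing \<sigma>'" "finite \<sigma> \<Longrightarrow> card \<sigma> < card \<sigma>'"
proof -
  have JV: "J \<subseteq> V" "V - J \<noteq> {}" using assms(5,6) by (auto simp: interval_in_def)
  have d: "V \<inter> W = {}" if "W \<in> \<sigma>" "W \<noteq> V" for W
    using partition_on_unique[OF assms(1,3) that(1)] that(2) by blast
  have nJ: "J \<notin> \<sigma> - {V}" "V - J \<notin> \<sigma> - {V}" "J \<noteq> V - J"
    using d JV assms(4,5) by blast+
  show "partition_on A \<sigma>'"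
  proof (rule partition_onI)
    show "\<Union>\<sigma>' = A" using assms(1,3) JV by (auto simp: partition_on_def \<sigma>'_def)
    show "{} \<notin> \<sigma>'" using assms(1,4) JV by (auto simp: partition_on_def \<sigma>'_def)
    fix p q assume "p \<in> \<sigma>'" "q \<in> \<sigma>'" "p \<noteq> q"
    then show "disjnt p q"
      using JV d partition_on_unique[OF assms(1)] unfolding \<sigma>'_def disjnt_def by blast
  qed
  show "non_crossing \<sigma>'"
  proof (rule non_crossingI)
    fix p q a b c d
    assume pq: "p \<in> \<sigma>'" "q \<in> \<sigma>'" "p \<noteq> q"
      and o: "a < b" "b < c" "c < d" and m: "a \<in> p" "c \<in> p" "b \<in> q" "d \<in> q"
    \<comment> \<open>\<open>up\<close> sends a block of \<open>\<sigma>'\<close> to the block of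
      \<open>\<sigma>\<close> containing it, so a crossing of \<open>p\<close> and \<open>q\<close>
      is lifted to \<open>\<sigma>\<close> and leaves only the two halves of
      \<open>V\<close>.\<close>
    define up where "up p = (if p = J \<or> p = V - J then V else p)" for p
    have up: "up p \<in> \<sigma>" "up q \<in> \<sigma>" "p \<subseteq> up p" "q \<subseteq> up q"
      using pq assms(3) JV by (auto simp: up_def \<sigma>'_def)
    have "up p = up q" by (rule non_crossingD[OF assms(2) up(1,2) o]) (use up m in auto)
    then have "p = J \<and> q = V - J \<or> p = V - J \<and> q = J"
      using pq nJ unfolding up_def \<sigma>'_def by (auto split: if_splits)
    then show False using m o assms(6) JV unfolding interval_in_def by blast
  qed
  assume "finite \<sigma>"
  then have "card \<sigma>' = Suc (Suc (card (\<sigma> - {V})))"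
    using nJ by (simp add: \<sigma>'_def)
  also have "\<dots> = Suc (card \<sigma>)" using \<open>finite \<sigma>\<close> assms(3) by (metis card_Suc_Diff1)
  finally show "card \<sigma> < card \<sigma>'" by simp
qed

text \<open>A finest non-crossing partition coarser than both pairings works: a reducible block could be split further.\<close>

lemma ex_irreducible_decomposition:
  assumes "finite A" "A \<noteq> {}" "u \<in> nc_pairings A" "l \<in> nc_pairings A"
  shows "\<exists>\<sigma>. partition_on A \<sigma> \<and> non_crossing \<sigma> \<and> subordinate u \<sigma> \<and> subordinate l \<sigma> \<and>
    (\<forall>V\<in>\<sigma>. irreducible_pair V (restr u V) (restr l V))"
proof -
  define S where "S = {\<sigma>. partition_on A \<sigma> \<and> non_crossing \<sigma> \<and> subordinate u \<sigma> \<and> subordinate l \<sigma>}"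
  have sub: "p \<subseteq> A" if "p \<in> u \<or> p \<in> l" for p
    using that assms(3,4) by (auto simp: nc_pairings_def partition_on_def)
  have "{A} \<in> S"
    using sub assms(2) by (auto simp: S_def subordinate_def non_crossing_def partition_on_space)
  moreover have "finite S"
    by (rule finite_subset[of _ "Pow (Pow A)"])
      (auto simp: S_def partition_on_def assms(1))
  ultimately have "Max (card ` S) \<in> card ` S" by (intro Max_in) auto
  then obtain \<sigma> where \<sigma>: "\<sigma> \<in> S" "card \<sigma> = Max (card ` S)" by auto
  have max: "card \<tau> \<le> card \<sigma>" if "\<tau> \<in> S" for \<tau>
    unfolding \<sigma>(2) using \<open>finite S\<close> that by simp
  have P: "partition_on A \<sigma>" "non_crossing \<sigma>" "subordinate u \<sigma>" "subordinate l \<sigma>"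
    using \<sigma>(1) by (auto simp: S_def)
  have "irreducible_pair V (restr u V) (restr l V)" if V: "V \<in> \<sigma>" for V
  proof (rule ccontr)
    assume "\<not> irreducible_pair V (restr u V) (restr l V)"
    then obtain J where J: "J \<noteq> {}" "J \<noteq> V" "interval_in V J"
      "saturated (restr u V) J" "saturated (restr l V) J"
      unfolding irreducible_pair_def by blast
    let ?s = "insert J (insert (V - J) (\<sigma> - {V}))"
    note sb = split_block[OF P(1,2) V J(1,2,3)]
    have "subordinate x ?s" if x: "subordinate x \<sigma>" "saturated (restr x V) J" for x
      unfolding subordinate_def
    proof
      fix p assume p: "p \<in> x"
      show "\<exists>V\<in>?s. p \<subseteq> V"
      proof (cases "p \<subseteq> V")
        case True
        then show ?thesis using x(2) p by (auto simp: saturated_def restr_def)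
      next
        case False
        obtain W where "W \<in> \<sigma>" "p \<subseteq> W" using x(1) p by (auto simp: subordinate_def)
        with False show ?thesis by auto
      qed
    qed
    then have "?s \<in> S" using sb(1,2) P J by (simp add: S_def)
    moreover have "finite \<sigma>" using assms(1) P(1) by (rule finite_elements)
    ultimately show False using max sb(3) by fastforce
  qed
  then show ?thesis using P by blast
qed

text \<open>Restricting to the blocks and taking unions are mutually inverse, so a pair decomposed
  by \<open>\<sigma>\<close> is an independent choice of an irreducible pair on each block.\<close>

lemma card_decomposed_pairs:
  assumes "finite A" "partition_on A \<sigma>" "non_crossing \<sigma>"
  shows "card {(u, l). u \<in> nc_pairings A \<and> l \<in> nc_pairings A \<and> subordinate u \<sigma> \<and> subordinate l \<sigma> \<and>
      (\<forall>V\<in>\<sigma>. irreducible_pair V (restr u V) (restr l V))} = (\<Prod>V\<in>\<sigma>. card (irr_pairs V))"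
    (is "card ?S = _")
proof -
  have \<sigma>: "disjoint \<sigma>" "\<Union>\<sigma> = A" using assms(2) by (auto simp: partition_on_def)
  let ?f = "\<lambda>(u, l). \<lambda>V\<in>\<sigma>. (restr u V, restr l V)"
  let ?g = "\<lambda>h. (\<Union>V\<in>\<sigma>. fst (h V), \<Union>V\<in>\<sigma>. snd (h V))"
  have "bij_betw ?f ?S (PiE \<sigma> irr_pairs)"
  proof (rule bij_betwI[where g = ?g])
    show "?f \<in> ?S \<rightarrow> PiE \<sigma> irr_pairs"
      using \<sigma> by (auto simp: irr_pairs_def intro!: restr_nc_pairing[of _ A \<sigma>])
    show "?g (?f x) = x" if "x \<in> ?S" for x
      using that by (auto simp: restr_def subordinate_def)
    show "?f (?g h) = h" if h: "h \<in> PiE \<sigma> irr_pairs" for h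
    proof (rule ext)
      fix V
      have "fst (h W) \<in> nc_pairings W" "snd (h W) \<in> nc_pairings W" if "W \<in> \<sigma>" for W
        using PiE_mem[OF h that] by (auto simp: irr_pairs_def)
      then show "?f (?g h) V = h V"
        using PiE_arb[OF h, of V] by (auto simp: restr_Union[OF \<sigma>(1)])
    qed
    show "?g \<in> PiE \<sigma> irr_pairs \<rightarrow> ?S"
    proof
      fix h assume h: "h \<in> PiE \<sigma> irr_pairs"
      have n: "fst (h W) \<in> nc_pairings W" "snd (h W) \<in> nc_pairings W"
          "irreducible_pair W (fst (h W)) (snd (h W))" if "W \<in> \<sigma>" for W
        using PiE_mem[OF h that] by (auto simp: irr_pairs_def)
      then show "?g h \<in> ?S"
        using Union_nc_pairings[OF \<sigma>(1) assms(3), of "\<lambda>V. fst (h V)"]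
          Union_nc_pairings[OF \<sigma>(1) assms(3), of "\<lambda>V. snd (h V)"]
        by (auto simp: restr_Union[OF \<sigma>(1)] \<sigma>(2) intro!: subordinate_Union)
    qed
  qed
  then have "card ?S = card (PiE \<sigma> irr_pairs)" by (rule bij_betw_same_card)
  also have "\<dots> = (\<Prod>V\<in>\<sigma>. card (irr_pairs V))"
    using assms(1,2) by (intro card_PiE finite_elements)
  finally show ?thesis .
qed

text \<open>Each product counts the pairs decomposed by \<open>\<sigma>\<close>. These sets are
  disjoint by uniqueness of the decomposition and exhaust all pairs by its existence.\<close>

lemma sum_NC_irr_pairs:
  assumes "n \<ge> 1"
  shows "(\<Sum>\<sigma>\<in>NC n. \<Prod>V\<in>\<sigma>. card (irr_pairs V)) = (card (nc_pairings {1..n}))\<^sup>2"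
proof -
  let ?A = "{1..n}"
  define D where "D \<sigma> = {(u, l). u \<in> nc_pairings ?A \<and> l \<in> nc_pairings ?A \<and> subordinate u \<sigma> \<and> subordinate l \<sigma> \<and>
      (\<forall>V\<in>\<sigma>. irreducible_pair V (restr u V) (restr l V))}" for \<sigma>
  have fin: "finite (nc_pairings ?A \<times> nc_pairings ?A)" by (simp add: finite_nc_pairings)
  have "(\<Sum>\<sigma>\<in>NC n. \<Prod>V\<in>\<sigma>. card (irr_pairs V)) = (\<Sum>\<sigma>\<in>NC n. card (D \<sigma>))"
    unfolding D_def by (intro sum.cong card_decomposed_pairs[symmetric]) (auto simp: NC_def)
  also have "\<dots> = card (\<Union>\<sigma>\<in>NC n. D \<sigma>)"
  proof (rule card_UN_disjoint[symmetric])
    show "finite (NC n)" by (rule finite_NC)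
    show "\<forall>\<sigma>\<in>NC n. finite (D \<sigma>)"
      by (intro ballI finite_subset[OF _ fin]) (auto simp: D_def)
    show "\<forall>\<sigma>\<in>NC n. \<forall>\<tau>\<in>NC n. \<sigma> \<noteq> \<tau> \<longrightarrow> D \<sigma> \<inter> D \<tau> = {}"
    proof (intro ballI impI, rule ccontr)
      fix \<sigma> \<tau> assume st: "\<sigma> \<in> NC n" "\<tau> \<in> NC n" "\<sigma> \<noteq> \<tau>" "D \<sigma> \<inter> D \<tau> \<noteq> {}"
      then obtain u l where "(u, l) \<in> D \<sigma>" "(u, l) \<in> D \<tau>" by auto
      then have "\<sigma> = \<tau>" using st
        by (intro irreducible_decomposition_unique[of ?A \<sigma> \<tau> u l]) (auto simp: D_def NC_def)
      with st show False by simp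
    qed
  qed
  also have "(\<Union>\<sigma>\<in>NC n. D \<sigma>) = nc_pairings ?A \<times> nc_pairings ?A"
  proof (intro equalityI subsetI)
    fix x assume "x \<in> nc_pairings ?A \<times> nc_pairings ?A"
    then obtain u l where x: "x = (u, l)" "u \<in> nc_pairings ?A" "l \<in> nc_pairings ?A" by auto
    then show "x \<in> (\<Union>\<sigma>\<in>NC n. D \<sigma>)"
      using ex_irreducible_decomposition[of ?A u l] assms by (auto simp: D_def NC_def)
  qed (auto simp: D_def)
  also have "card \<dots> = (card (nc_pairings ?A))\<^sup>2"
    by (simp add: card_cartesian_product power2_eq_square)
  finally show ?thesis .
qed

subsection \<open>Transport along increasing bijections\<close>

lemma image_nc_pairing:
  assumes f: "strict_mono_on A f" and u: "u \<in> nc_pairings A"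
  shows "(`) f ` u \<in> nc_pairings (f ` A)"
proof -
  note u = nc_pairingsD[OF u]
  have inj: "inj_on f A" using f by (rule strict_mono_on_imp_inj_on)
  have sub: "p \<subseteq> A" "p \<noteq> {}" if "p \<in> u" for p using that u(1) by (auto simp: partition_on_def)
  have "partition_on (f ` A) ((`) f ` u - {{}})"
    using u(1) inj by (rule partition_on_inj_image)
  moreover have "{} \<notin> (`) f ` u" using sub by auto
  ultimately have "partition_on (f ` A) ((`) f ` u)" by simp
  moreover have "non_crossing ((`) f ` u)"
  proof (rule non_crossingI)
    fix V W a b c d
    assume VW: "V \<in> (`) f ` u" "W \<in> (`) f ` u" "V \<noteq> W"
      and o: "a < b" "b < c" "c < d" and m: "a \<in> V" "c \<in> V" "b \<in> W" "d \<in> W"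
    obtain p q where pq: "p \<in> u" "q \<in> u" "V = f ` p" "W = f ` q" using VW by blast
    obtain a' b' c' d' where m': "a = f a'" "b = f b'" "c = f c'" "d = f d'"
      "a' \<in> p" "c' \<in> p" "b' \<in> q" "d' \<in> q"
      using m pq by blast
    have lt: "x < y" if "f x < f y" "x \<in> A" "y \<in> A" for x y
      using strict_mono_on_less[OF f that(2,3)] that(1) by simp
    have "a' < b'" "b' < c'" "c' < d'"
      using o m' sub[OF pq(1)] sub[OF pq(2)] by (auto intro!: lt)
    from non_crossingD[OF u(2) pq(1,2) this m'(5-8)] have "p = q" .
    then show False using VW pq by simp
  qed
  moreover have "card p = 2" if "p \<in> (`) f ` u" for p
  proof -
    obtain q where q: "q \<in> u" "p = f ` q" using \<open>p \<in> (`) f ` u\<close> by blast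
    have "inj_on f q" using inj sub(1)[OF q(1)] by (rule inj_on_subset)
    then show ?thesis using q u(3) by (simp add: card_image)
  qed
  ultimately show ?thesis by (simp add: nc_pairings_def)
qed

lemma image_irreducible_pair:
  assumes f: "strict_mono_on A f" and u: "u \<in> nc_pairings A" and l: "l \<in> nc_pairings A"
    and irr: "irreducible_pair A u l"
  shows "irreducible_pair (f ` A) ((`) f ` u) ((`) f ` l)"
  unfolding irreducible_pair_def
proof
  assume "\<exists>J. J \<noteq> {} \<and> J \<noteq> f ` A \<and> interval_in (f ` A) J \<and>
    saturated ((`) f ` u) J \<and> saturated ((`) f ` l) J"
  then obtain J where J: "J \<noteq> {}" "J \<noteq> f ` A" "interval_in (f ` A) J"
    "saturated ((`) f ` u) J" "saturated ((`) f ` l) J" by blast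
  define K where "K = {x \<in> A. f x \<in> J}"
  have KJ: "f ` K = J" using J(3) by (auto simp: K_def interval_in_def)
  have "interval_in A K"
    unfolding interval_in_def
  proof (intro conjI ballI impI)
    show "K \<subseteq> A" by (auto simp: K_def)
    fix x z y assume "x \<in> K" "z \<in> K" and y: "y \<in> A" "x < y \<and> y < z"
    then have xz: "x \<in> A" "z \<in> A" "f x \<in> J" "f z \<in> J" by (auto simp: K_def)
    have "f x < f y" "f y < f z" using f xz y by (auto simp: strict_mono_on_def)
    then have "f y \<in> J" using J(3) xz y unfolding interval_in_def by blast
    then show "y \<in> K" using y by (simp add: K_def)
  qed
  moreover have "saturated x K" if x: "x \<in> nc_pairings A" "saturated ((`) f ` x) J" for x
    unfolding saturated_def
  proof
    fix p assume p: "p \<in> x"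
    have "p \<subseteq> A" using p nc_pairingsD(1)[OF x(1)] by (auto simp: partition_on_def)
    moreover have "f ` p \<subseteq> J \<or> f ` p \<inter> J = {}" using x(2) p by (auto simp: saturated_def)
    ultimately show "p \<subseteq> K \<or> p \<inter> K = {}" by (auto simp: K_def)
  qed
  moreover have "K \<noteq> {}" "K \<noteq> A" using J KJ by auto
  ultimately show False using irr u l J(4,5) unfolding irreducible_pair_def by blast
qed

lemma inj_on_image_image: "inj_on f A \<Longrightarrow> inj_on ((`) ((`) f)) (Pow (Pow A))"
  by (intro inj_on_image_Pow)

lemma nc_pairings_subset_Pow: "nc_pairings A \<subseteq> Pow (Pow A)"
  by (auto simp: nc_pairings_def partition_on_def)

text \<open>An inequality suffices: the inverse of an increasing bijection is again increasing, and
  applying the bound to it gives the converse.\<close>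

lemma card_image_le_nc_pairings:
  assumes f: "strict_mono_on A f" and fin: "finite A"
  shows "card (nc_pairings A) \<le> card (nc_pairings (f ` A))"
proof (rule card_inj_on_le)
  show "inj_on ((`) ((`) f)) (nc_pairings A)"
    by (rule inj_on_subset[OF inj_on_image_image nc_pairings_subset_Pow])
      (rule strict_mono_on_imp_inj_on[OF f])
  show "(`) ((`) f) ` nc_pairings A \<subseteq> nc_pairings (f ` A)" using image_nc_pairing[OF f] by blast
qed (simp add: finite_nc_pairings fin)

lemma card_image_le_irr_pairs:
  assumes f: "strict_mono_on A f" and fin: "finite A"
  shows "card (irr_pairs A) \<le> card (irr_pairs (f ` A))"
proof (rule card_inj_on_le)
  let ?g = "(`) ((`) f)"
  have "inj_on ?g (nc_pairings A)"
    by (rule inj_on_subset[OF inj_on_image_image nc_pairings_subset_Pow])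
      (rule strict_mono_on_imp_inj_on[OF f])
  then have "inj_on (map_prod ?g ?g) (nc_pairings A \<times> nc_pairings A)"
    by (intro map_prod_inj_on)
  then show "inj_on (map_prod ?g ?g) (irr_pairs A)"
    by (rule inj_on_subset) (auto simp: irr_pairs_def)
  show "map_prod ?g ?g ` irr_pairs A \<subseteq> irr_pairs (f ` A)"
    using image_nc_pairing[OF f] image_irreducible_pair[OF f] by (auto simp: irr_pairs_def)
qed (simp add: finite_irr_pairs fin)

lemma ex_strict_mono_on_card:
  fixes V :: "nat set"
  assumes "finite V"
  shows "\<exists>f. strict_mono_on {1..card V} f \<and> f ` {1..card V} = V"
proof (intro exI conjI)
  let ?xs = "sorted_list_of_set V"
  let ?f = "\<lambda>i. ?xs ! (i - 1)"
  have len: "length ?xs = card V" by simp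
  show "strict_mono_on {1..card V} ?f"
  proof (rule strict_mono_onI)
    fix r s assume "r \<in> {1..card V}" "s \<in> {1..card V}" "r < s"
    then show "?xs ! (r - 1) < ?xs ! (s - 1)"
      using len by (intro sorted_wrt_nth_less[OF strict_sorted_list_of_set]) auto
  qed
  have "?f ` {1..card V} = (!) ?xs ` ((\<lambda>i. i - 1) ` {1..card V})" by (simp add: image_image)
  also have "(\<lambda>i. i - 1) ` {1..card V} = {..<card V}"
    by (force simp: image_iff intro: bexI[of _ "Suc _"])
  also have "(!) ?xs ` {..<card V} = set ?xs"
    by (auto simp: set_conv_nth)
  finally show "?f ` {1..card V} = V" using assms by simp
qed

lemma strict_mono_on_inv_into:
  fixes f :: "'a::linorder \<Rightarrow> 'b::linorder"
  assumes "strict_mono_on A f"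
  shows "strict_mono_on (f ` A) (inv_into A f)"
proof (rule strict_mono_onI)
  fix r s assume rs: "r \<in> f ` A" "s \<in> f ` A" "r < s"
  then have "inv_into A f r \<in> A" "inv_into A f s \<in> A" by (auto intro: inv_into_into)
  then show "inv_into A f r < inv_into A f s"
    using strict_mono_on_less[OF assms] rs by (metis f_inv_into_f)
qed

lemma card_irr_pairs_card:
  assumes "finite V"
  shows "card (irr_pairs V) = card (irr_pairs {1..card V})"
proof -
  obtain f where f: "strict_mono_on {1..card V} f" "f ` {1..card V} = V"
    using ex_strict_mono_on_card[OF assms] by blast
  let ?g = "inv_into {1..card V} f"
  have "?g ` V = {1..card V}"
    using strict_mono_on_imp_inj_on[OF f(1)] f(2) by (metis inv_into_image_cancel order_refl)
  then show ?thesis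
    using card_image_le_irr_pairs[OF f(1)] f(2) assms
      card_image_le_irr_pairs[OF strict_mono_on_inv_into[OF f(1)]] by simp
qed

lemma card_nc_pairings_card:
  assumes "finite V"
  shows "card (nc_pairings V) = card (nc_pairings {1..card V})"
proof -
  obtain f where f: "strict_mono_on {1..card V} f" "f ` {1..card V} = V"
    using ex_strict_mono_on_card[OF assms] by blast
  let ?g = "inv_into {1..card V} f"
  have "?g ` V = {1..card V}"
    using strict_mono_on_imp_inj_on[OF f(1)] f(2) by (metis inv_into_image_cancel order_refl)
  then show ?thesis
    using card_image_le_nc_pairings[OF f(1)] f(2) assms
      card_image_le_nc_pairings[OF strict_mono_on_inv_into[OF f(1)]] by simp
qed

subsection \<open>Non-crossing partitions as non-crossing pairings\<close>

lemma arc_no_crossing: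
  assumes u: "u \<in> nc_pairings A" and ab: "{a, b} \<in> u" "a < b"
    and p: "p \<in> u" "p \<noteq> {a, b}" "x \<in> p" "y \<in> p" and x: "a < x" "x < b"
  shows "a < y \<and> y < b"
proof (rule ccontr)
  note u = nc_pairingsD[OF u]
  assume "\<not> (a < y \<and> y < b)"
  moreover have "y \<noteq> a" "y \<noteq> b" using partition_on_unique[OF u(1) ab(1) p(1)] p by auto
  ultimately have "y < a \<or> b < y" by auto
  then show False
    using non_crossingD[OF u(2) p(1) ab(1), of y a x b]
      non_crossingD[OF u(2) ab(1) p(1), of a x b y] p x by auto
qed

text \<open>No arc leaves the open interval under \<open>{a, b}\<close>, so the pairing restricts to
  a pairing of that interval.\<close>

lemma arc_inside_even:
  assumes u: "u \<in> nc_pairings {1..n}" and ab: "{a, b} \<in> u" "a < b"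
  shows "even (b - a - 1)"
proof -
  have P: "partition_on {1..n} u" using nc_pairingsD[OF u] by auto
  have ab': "1 \<le> a" "b \<le> n" using P ab by (auto simp: partition_on_def)
  let ?I = "{a<..<b}"
  have "subordinate u {?I, {1..n} - ?I}"
    unfolding subordinate_def
  proof
    fix p assume p: "p \<in> u"
    have pA: "p \<subseteq> {1..n}" using P p by (auto simp: partition_on_def)
    show "\<exists>V\<in>{?I, {1..n} - ?I}. p \<subseteq> V"
    proof (cases "p \<inter> ?I = {}")
      case True then show ?thesis using pA by auto
    next
      case False
      then obtain x where x: "x \<in> p" "a < x" "x < b" by auto
      then have "p \<noteq> {a, b}" by auto
      then have "p \<subseteq> ?I" using arc_no_crossing[OF u ab p _ x(1) _ x(2,3)] by auto
      then show ?thesis by blast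
    qed
  qed
  then have "restr u ?I \<in> nc_pairings ?I"
    using ab' by (intro restr_nc_pairing[OF u]) (auto simp: disjoint_def)
  from nc_pairing_even_card[OF _ this] show ?thesis by simp
qed

text \<open>The second disjunct is the wrap-around from the maximum of \<open>V\<close> to its minimum.\<close>

definition cyclic_succ :: "nat set \<Rightarrow> nat \<Rightarrow> nat \<Rightarrow> bool" where
  "cyclic_succ V i j \<longleftrightarrow> j \<in> V \<and>
     (i < j \<and> (\<forall>k\<in>V. \<not> (i < k \<and> k < j)) \<or> (\<forall>k\<in>V. j \<le> k \<and> k \<le> i))"

lemma cyclic_succ_unique:
  assumes "cyclic_succ V i j" "cyclic_succ V i k" "i \<in> V"
  shows "j = k"
  using assms unfolding cyclic_succ_def by (metis leD le_antisym linorder_neqE_nat)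

text \<open>Trades the \<open>THE\<close>, \<open>Max\<close> and \<open>Min\<close> of
  \<open>block_cycle\<close> for plain order statements; together with
  \<open>cyclic_succ_unique\<close> it determines the value of \<open>block_cycle\<close>.\<close>

lemma block_cycle_cyclic_succ:
  assumes P: "partition_on {1..n} \<pi>" and V: "V \<in> \<pi>" "i \<in> V"
  shows "cyclic_succ V i (block_cycle \<pi> i)"
proof -
  have "(THE V. V \<in> \<pi> \<and> i \<in> V) = V"
    using partition_on_unique[OF P] V by (intro the_equality) auto
  then have bc: "block_cycle \<pi> i = (if i = Max V then Min V else Min {j \<in> V. i < j})"
    using V by (auto simp: block_cycle_def)
  have fin: "finite V" using P V(1) by (intro finite_subset[of V "{1..n}"]) (auto simp: partition_on_def)
  show ?thesis
  proof (cases "i = Max V")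
    case True
    then show ?thesis using bc fin V(2) by (auto simp: cyclic_succ_def intro: Min_in)
  next
    case False
    let ?S = "{j \<in> V. i < j}"
    have S: "finite ?S" "?S \<noteq> {}"
    proof -
      have "Max V \<in> V" "i < Max V"
        using False V(2) Max_in[OF fin] Max_ge[OF fin V(2)] by fastforce+
      then show "?S \<noteq> {}" by blast
    qed (use fin in simp)
    have "Min ?S \<in> ?S" using S by (rule Min_in)
    moreover have "\<not> (i < k \<and> k < Min ?S)" if "k \<in> V" for k
      using that Min_le[OF S(1), of k] by auto
    ultimately show ?thesis using bc False by (auto simp: cyclic_succ_def)
  qed
qed

text \<open>The boundary of the thickened blocks: \<open>i\<close> is doubled into a left copy
  \<open>2 * i - 1\<close> and a right copy \<open>2 * i\<close>, and an arc joins the right copy of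
  \<open>i\<close> to the left copy of its successor.\<close>

definition fatten :: "nat \<Rightarrow> nat set set \<Rightarrow> nat set set" where
  "fatten n \<pi> = (\<lambda>i. {2 * i, 2 * block_cycle \<pi> i - 1}) ` {1..n}"

lemma fatten_nc_pairing:
  assumes "\<pi> \<in> NC n"
  shows "fatten n \<pi> \<in> nc_pairings {1..2 * n}"
proof -
  have P: "partition_on {1..n} \<pi>" and nc: "non_crossing \<pi>" using assms by (auto simp: NC_def)
  let ?P = "block_cycle \<pi>"
  have perm: "?P permutes {1..n}" using P by (rule block_cycle_permutes)
  have rng: "1 \<le> ?P i" "?P i \<le> n" if "i \<in> {1..n}" for i
    using permutes_in_image[OF perm, of i] that by auto
  have inj: "i = j" if "?P i = ?P j" for i j using permutes_inj[OF perm] that by (auto dest: injD)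
  have "\<Union>(fatten n \<pi>) = {1..2 * n}"
  proof (intro equalityI subsetI)
    fix x assume "x \<in> \<Union>(fatten n \<pi>)"
    then obtain i where i: "i \<in> {1..n}" "x = 2 * i \<or> x = 2 * ?P i - 1" by (auto simp: fatten_def)
    show "x \<in> {1..2 * n}" using i(2) i(1) rng[OF i(1)] by auto
  next
    fix x assume x: "x \<in> {1..2 * n}"
    show "x \<in> \<Union>(fatten n \<pi>)"
    proof (cases "even x")
      case True
      then obtain i where "x = 2 * i" by (rule evenE)
      then show ?thesis using x by (auto simp: fatten_def intro!: bexI[of _ i])
    next
      case False
      then obtain j where j: "x = 2 * j + 1" by (rule oddE)
      then have "Suc j \<in> ?P ` {1..n}" using x permutes_image[OF perm] by auto
      then obtain i where "i \<in> {1..n}" "?P i = Suc j" by auto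
      then show ?thesis using j by (auto simp: fatten_def intro!: bexI[of _ i])
    qed
  qed
  moreover have "disjnt p q" if pq: "p \<in> fatten n \<pi>" "q \<in> fatten n \<pi>" "p \<noteq> q" for p q
  proof -
    obtain i j where ij: "i \<in> {1..n}" "p = {2 * i, 2 * ?P i - 1}" "j \<in> {1..n}" "q = {2 * j, 2 * ?P j - 1}"
      using pq unfolding fatten_def by blast
    then have "i \<noteq> j" using pq by auto
    moreover from this have "?P i \<noteq> ?P j" using inj by auto
    moreover have "2 * i \<noteq> 2 * ?P j - 1" "2 * j \<noteq> 2 * ?P i - 1"
      using rng[OF ij(1)] rng[OF ij(3)] by presburger+
    ultimately show ?thesis using ij rng[OF ij(1)] rng[OF ij(3)] by (auto simp: disjnt_def)
  qed
  moreover have "{} \<notin> fatten n \<pi>" by (auto simp: fatten_def)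
  ultimately have "partition_on {1..2 * n} (fatten n \<pi>)" by (intro partition_onI)
  moreover have "card p = 2" if pF: "p \<in> fatten n \<pi>" for p
  proof -
    obtain i where i: "i \<in> {1..n}" "p = {2 * i, 2 * ?P i - 1}" using pF unfolding fatten_def by blast
    have "2 * i \<noteq> 2 * ?P i - 1" using rng[OF i(1)] by presburger
    then show ?thesis using i by simp
  qed
  moreover have "non_crossing (fatten n \<pi>)"
  proof (rule non_crossingI)
    fix p q a b c d
    assume pq: "p \<in> fatten n \<pi>" "q \<in> fatten n \<pi>" "p \<noteq> q"
      and o: "a < b" "b < c" "c < d" and m: "a \<in> p" "c \<in> p" "b \<in> q" "d \<in> q"
    obtain i k where ik: "i \<in> {1..n}" "p = {2 * i, 2 * ?P i - 1}" "k \<in> {1..n}" "q = {2 * k, 2 * ?P k - 1}"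
      using pq unfolding fatten_def by blast
    obtain V W where VW: "V \<in> \<pi>" "i \<in> V" "W \<in> \<pi>" "k \<in> W"
      using partition_on_mem[OF P ik(1)] partition_on_mem[OF P ik(3)] by metis
    define j where "j = ?P i"
    define l where "l = ?P k"
    have j: "cyclic_succ V i j" and l: "cyclic_succ W k l"
      unfolding j_def l_def using block_cycle_cyclic_succ[OF P] VW by auto
    then have jl: "j \<in> V" "l \<in> W" by (auto simp: cyclic_succ_def)
    have jl1: "1 \<le> j" "1 \<le> l" using rng ik unfolding j_def l_def by auto
    have cross: "V = W" if "w < x" "x < y" "y < z"
      "w \<in> V \<and> y \<in> V \<and> x \<in> W \<and> z \<in> W" for w x y z
      using non_crossingD[OF nc VW(1,3) that(1-3)] that(4) by auto
    have meet: "V = W" if "x \<in> V" "x \<in> W" for x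
      using partition_on_unique[OF P VW(1,3) that] .
    have ac: "a = 2 * i \<and> c = 2 * j - 1 \<or> a = 2 * j - 1 \<and> c = 2 * i"
      using m o ik unfolding j_def by auto
    have bd: "b = 2 * k \<and> d = 2 * l - 1 \<or> b = 2 * l - 1 \<and> d = 2 * k"
      using m o ik unfolding l_def by auto
    \<comment> \<open>One case for each choice of orientation of the two arcs. An odd end before an
      even one gives only a weak inequality on indices, whence \<open>meet\<close> besides
      \<open>cross\<close>. Once \<open>V = W\<close>, that block has a point which contradicts that
      \<open>j\<close> succeeds \<open>i\<close>: one strictly between \<open>i\<close> and
      \<open>j\<close>, or, when the cycle wraps around, one above \<open>i\<close>.\<close>
    consider "i < k" "k < j" "j < l" | "i < l" "l < j" "j \<le> k"
      | "j \<le> k" "k < i" "i < l" | "j < l" "l \<le> i" "i < k"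
      using ac bd o jl1 by linarith
    then show False
    proof cases
      case 1
      then have "V = W" using cross[of i k j l] VW jl by auto
      then show False using j 1 VW jl by (auto simp: cyclic_succ_def)
    next
      case 2
      then have "V = W" using cross[of i l j k] meet[of j] VW jl by (cases "j = k") auto
      then show False using j 2 VW jl by (auto simp: cyclic_succ_def)
    next
      case 3
      then have "V = W" using cross[of j k i l] meet[of j] VW jl by (cases "j = k") auto
      then show False using j 3 VW jl by (auto simp: cyclic_succ_def)
    next
      case 4
      then have "V = W" using cross[of j l i k] meet[of i] VW jl by (cases "l = i") auto
      then show False using j 4 VW jl by (auto simp: cyclic_succ_def)
    qed
  qed
  ultimately show ?thesis by (simp add: nc_pairings_def)
qed

text \<open>Iterating the common cycle from \<open>Min V\<close> runs upwards through
  \<open>V\<close> and reaches each of its points before wrapping around, while the cycle of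
  \<open>\<rho>\<close> never leaves the block \<open>W\<close> of \<open>Min V\<close>.\<close>

lemma block_cycle_refines:
  assumes P: "partition_on {1..n} \<pi>" and R: "partition_on {1..n} \<rho>"
    and eq: "\<And>i. i \<in> {1..n} \<Longrightarrow> block_cycle \<pi> i = block_cycle \<rho> i"
    and V: "V \<in> \<pi>"
  shows "\<exists>W\<in>\<rho>. V \<subseteq> W"
proof -
  have VS: "V \<subseteq> {1..n}" "V \<noteq> {}" using P V by (auto simp: partition_on_def)
  then have fin: "finite V" by (auto intro: finite_subset)
  have Min: "Min V \<in> V" using fin VS(2) by (rule Min_in)
  obtain W where W: "W \<in> \<rho>" "Min V \<in> W" using partition_on_mem[OF R] Min VS(1) by blast
  have step: "j \<in> W" if "i \<in> V" "j \<in> V" "i \<le> j" "i \<in> W" for i j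
    using that
  proof (induction "j - i" arbitrary: i rule: less_induct)
    case less
    show ?case
    proof (cases "i = j")
      case False
      then have ij: "i < j" using less.prems by simp
      have 1: "cyclic_succ V i (block_cycle \<pi> i)"
        using less.prems by (intro block_cycle_cyclic_succ[OF P V])
      have 2: "cyclic_succ W i (block_cycle \<rho> i)"
        using less.prems by (intro block_cycle_cyclic_succ[OF R W(1)])
      have e: "block_cycle \<pi> i = block_cycle \<rho> i" using eq less.prems VS by auto
      have "i < block_cycle \<pi> i" "block_cycle \<pi> i \<le> j" "block_cycle \<pi> i \<in> V"
        using 1 ij less.prems by (auto simp: cyclic_succ_def not_less)
      moreover have "block_cycle \<pi> i \<in> W" using 2 e by (simp add: cyclic_succ_def)
      ultimately show ?thesis using less.hyps[of "block_cycle \<pi> i"] less.prems by auto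
    qed (use less.prems in simp)
  qed
  have "V \<subseteq> W" using step[OF Min] W fin by auto
  then show ?thesis using W by blast
qed

lemma inj_on_fatten: "inj_on (fatten n) (NC n)"
proof (rule inj_onI)
  fix \<pi> \<rho> assume pr: "\<pi> \<in> NC n" "\<rho> \<in> NC n" "fatten n \<pi> = fatten n \<rho>"
  have P: "partition_on {1..n} \<pi>" "partition_on {1..n} \<rho>" using pr by (auto simp: NC_def)
  have eq: "block_cycle \<pi> i = block_cycle \<rho> i" if i: "i \<in> {1..n}" for i
  proof -
    let ?p = "{2 * i, 2 * block_cycle \<pi> i - 1}" and ?q = "{2 * i, 2 * block_cycle \<rho> i - 1}"
    have "?p \<in> fatten n \<pi>" "?q \<in> fatten n \<rho>" using i unfolding fatten_def by blast+
    then have "?p \<in> fatten n \<pi>" "?q \<in> fatten n \<pi>" using pr(3) by auto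
    then have "?p = ?q"
      by (rule partition_on_unique[OF nc_pairingsD(1)[OF fatten_nc_pairing[OF pr(1)]]]) auto
    \<comment> \<open>Positivity makes the truncated subtraction in \<open>2 * x - 1\<close>
      injective.\<close>
    moreover have "block_cycle \<pi> i \<ge> 1" "block_cycle \<rho> i \<ge> 1"
      using i permutes_in_image[OF block_cycle_permutes[OF P(1)], of i]
        permutes_in_image[OF block_cycle_permutes[OF P(2)], of i] by auto
    ultimately show ?thesis by (auto simp: doubleton_eq_iff)
  qed
  show "\<pi> = \<rho>"
    using block_cycle_refines[OF P eq] block_cycle_refines[OF P(2,1) eq[symmetric]]
    by (intro partition_on_eqI[OF P])
qed

text \<open>
  The inverse of the map \<open>fatten\<close>: an arc encloses \<open>i\<close> if it passes over the point \<open>2i - 1/2\<close>, and two numbers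
  are in the same block iff they are enclosed by the same arcs, i.e. lie in the same region
  cut out by the arcs.
\<close>

definition enclosing_arcs :: "nat set set \<Rightarrow> nat \<Rightarrow> nat set set" where
  "enclosing_arcs u i = {p \<in> u. \<exists>a\<in>p. \<exists>b\<in>p. a < 2 * i \<and> 2 * i \<le> b}"

definition unfatten :: "nat \<Rightarrow> nat set set \<Rightarrow> nat set set" where
  "unfatten n u = (\<lambda>i. {j \<in> {1..n}. enclosing_arcs u j = enclosing_arcs u i}) ` {1..n}"

lemma enclosing_arcs_between:
  assumes "p \<in> enclosing_arcs u i" "p \<in> enclosing_arcs u k" "i \<le> j" "j \<le> k"
  shows "p \<in> enclosing_arcs u j"
proof -
  obtain a b where "p \<in> u" "a \<in> p" "b \<in> p" "a < 2 * i" "2 * k \<le> b"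
    using assms(1,2) by (auto simp: enclosing_arcs_def)
  moreover from this have "a < 2 * j" "2 * j \<le> b" using assms(3,4) by auto
  ultimately show ?thesis unfolding enclosing_arcs_def by blast
qed

text \<open>The numbers enclosed by a fixed arc are consecutive. If \<open>a\<close> and
  \<open>c\<close> have the same enclosing arcs, and so do \<open>b\<close> and \<open>d\<close>,
  then those of \<open>a\<close> enclose \<open>b\<close> and those of \<open>b\<close> enclose
  \<open>c\<close>, so all four agree.\<close>

lemma unfatten_NC: "unfatten n u \<in> NC n"
proof -
  have "partition_on {1..n} (unfatten n u)"
  proof (rule partition_onI)
    fix p q assume "p \<in> unfatten n u" "q \<in> unfatten n u" "p \<noteq> q"
    then show "disjnt p q" by (auto simp: unfatten_def disjnt_def)
  qed (auto simp: unfatten_def)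
  moreover have "non_crossing (unfatten n u)"
  proof (rule non_crossingI)
    fix V W a b c d
    assume VW: "V \<in> unfatten n u" "W \<in> unfatten n u" "V \<noteq> W"
      and o: "a < b" "b < c" "c < d" and m: "a \<in> V" "c \<in> V" "b \<in> W" "d \<in> W"
    let ?e = "enclosing_arcs u"
    have e: "?e a = ?e c" "?e b = ?e d" "?e a \<noteq> ?e b" using VW m by (auto simp: unfatten_def)
    have "?e a \<subseteq> ?e b" using enclosing_arcs_between[of _ u a c b] e(1) o by auto
    moreover have "?e b \<subseteq> ?e c" using enclosing_arcs_between[of _ u b d c] e(2) o by auto
    ultimately show False using e by auto
  qed
  ultimately show ?thesis by (simp add: NC_def)
qed

text \<open>The arc at \<open>2 * i\<close> ends at the left copy \<open>2 * j - 1\<close> of some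
  \<open>j\<close>, and this \<open>j\<close> is the cyclic successor of \<open>i\<close> within its
  region. An arc to the right gives the next element of the region; an arc to the left gives the
  wrap-around.\<close>

lemma fatten_unfatten:
  assumes u: "u \<in> nc_pairings {1..2 * n}"
  shows "fatten n (unfatten n u) = u"
proof -
  note U = nc_pairingsD[OF u]
  let ?\<pi> = "unfatten n u" and ?e = "enclosing_arcs u"
  have P: "partition_on {1..n} ?\<pi>" using unfatten_NC[of n u] by (simp add: NC_def)
  have arc: "{2 * i, 2 * block_cycle ?\<pi> i - 1} \<in> u" if i: "i \<in> {1..n}" for i
  proof -
    obtain p where p: "p \<in> u" "2 * i \<in> p" using partition_on_mem[OF U(1), of "2 * i"] i by auto
    obtain q where q: "p = {2 * i, q}" "q \<noteq> 2 * i"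
      using U(3)[OF p(1)] p(2) by (auto simp: card_2_iff)
    have q2: "q \<in> {1..2 * n}" using U(1) p q by (auto simp: partition_on_def)
    have notin: "2 * i \<notin> r" "q \<notin> r" if "r \<in> u" "r \<noteq> p" for r
      using partition_on_unique[OF U(1) p(1) that(1)] that(2) q by auto
    let ?V = "{k \<in> {1..n}. ?e k = ?e i}"
    have V: "?V \<in> ?\<pi>" "i \<in> ?V" using i by (auto simp: unfatten_def)
    note bc = block_cycle_cyclic_succ[OF P V]
    show ?thesis
    proof (cases "2 * i < q")
      case True
      \<comment> \<open>An even number of points under the arc means that its ends have opposite
        parity, so \<open>q\<close> is the left copy of some \<open>j\<close>.\<close>
      then have "even (q - 2 * i - 1)" using arc_inside_even[OF u, of "2 * i" q] p q by simp
      then have "odd q" using True by presburger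
      then obtain j0 where j0: "q = 2 * j0 + 1" by (rule oddE)
      define j where "j = Suc j0"
      have j: "q = 2 * j - 1" "i < j" "j \<in> {1..n}" using j0 True q2 by (auto simp: j_def)
      have j1: "1 \<le> j" by (simp add: j_def)
      \<comment> \<open>Every other arc has both ends on the same side of \<open>p\<close>, so it
        cannot separate \<open>i\<close> from \<open>j\<close>.\<close>
      have out: "(x < 2 * i \<or> q < x) = (y < 2 * i \<or> q < y)" if "r \<in> u" "r \<noteq> p" "x \<in> r" "y \<in> r" for r x y
      proof -
        have "x \<noteq> 2 * i" "x \<noteq> q" "y \<noteq> 2 * i" "y \<noteq> q" using notin[OF that(1,2)] that by auto
        then show ?thesis
          using arc_no_crossing[OF u _ True that(1) _ that(3,4)]
            arc_no_crossing[OF u _ True that(1) _ that(4,3)] that(2) p(1) q(1)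
          by (metis linorder_neqE_nat not_less_iff_gr_or_eq)
      qed
      \<comment> \<open>Here \<open>p\<close> encloses exactly the \<open>k\<close> with
        \<open>i < k\<close> and \<open>k < j\<close>; this excludes them from the region of
        \<open>i\<close>.\<close>
      have pi: "p \<notin> ?e i" "p \<notin> ?e j" using q True j by (auto simp: enclosing_arcs_def)
      have "r \<in> ?e i \<longleftrightarrow> r \<in> ?e j" for r
      proof (cases "r = p \<or> r \<notin> u")
        case True then show ?thesis using pi by (auto simp: enclosing_arcs_def)
      next
        case False
        then have r: "r \<in> u" "r \<noteq> p" by auto
        have "(a < 2 * i \<and> 2 * i \<le> b) = (a < 2 * j \<and> 2 * j \<le> b)" if "a \<in> r" "b \<in> r" for a b
        proof -
          have "a \<noteq> 2 * i" "a \<noteq> q" "b \<noteq> 2 * i" "b \<noteq> q" using notin[OF r] that by auto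
          then show ?thesis using out[OF r that] j(1,2) j1 by linarith
        qed
        then show ?thesis using r by (auto simp: enclosing_arcs_def)
      qed
      then have "?e j = ?e i" by blast
      moreover have "?e k \<noteq> ?e i" if "i < k" "k < j" for k
      proof -
        have "p \<in> ?e k" using p q j that by (auto simp: enclosing_arcs_def)
        then show ?thesis using pi by auto
      qed
      ultimately have "cyclic_succ ?V i j" using j by (auto simp: cyclic_succ_def)
      then have "block_cycle ?\<pi> i = j" using cyclic_succ_unique[OF bc _ V(2)] by simp
      then show ?thesis using p q j by simp
    next
      case False
      then have lt: "q < 2 * i" using q by simp
      have pp: "{q, 2 * i} = p" using q by auto
      then have "even (2 * i - q - 1)" using arc_inside_even[OF u, of q "2 * i"] p lt by simp
      then have "odd q" using lt by presburger
      then obtain j0 where j0: "q = 2 * j0 + 1" by (rule oddE)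
      define j where "j = Suc j0"
      have j: "q = 2 * j - 1" "j \<le> i" "j \<in> {1..n}" using j0 lt q2 i by (auto simp: j_def)
      have j1: "1 \<le> j" by (simp add: j_def)
      have out: "(x < q \<or> 2 * i < x) = (y < q \<or> 2 * i < y)" if "r \<in> u" "r \<noteq> p" "x \<in> r" "y \<in> r" for r x y
      proof -
        have "x \<noteq> 2 * i" "x \<noteq> q" "y \<noteq> 2 * i" "y \<noteq> q" using notin[OF that(1,2)] that by auto
        then show ?thesis
          using arc_no_crossing[OF u _ lt that(1) _ that(3,4)]
            arc_no_crossing[OF u _ lt that(1) _ that(4,3)] that(2) p(1) pp
          by (metis linorder_neqE_nat not_less_iff_gr_or_eq)
      qed
      \<comment> \<open>Here \<open>p\<close> encloses exactly the \<open>k\<close> from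
        \<open>j\<close> to \<open>i\<close>, both included, so these are the minimum and maximum of
        their region.\<close>
      have pi: "p \<in> ?e i" "p \<in> ?e j" using p q lt j by (auto simp: enclosing_arcs_def)
      have "r \<in> ?e i \<longleftrightarrow> r \<in> ?e j" for r
      proof (cases "r = p \<or> r \<notin> u")
        case True then show ?thesis using pi by (auto simp: enclosing_arcs_def)
      next
        case False
        then have r: "r \<in> u" "r \<noteq> p" by auto
        have "(a < 2 * i \<and> 2 * i \<le> b) = (a < 2 * j \<and> 2 * j \<le> b)" if "a \<in> r" "b \<in> r" for a b
        proof -
          have "a \<noteq> 2 * i" "a \<noteq> q" "b \<noteq> 2 * i" "b \<noteq> q" using notin[OF r] that by auto
          then show ?thesis using out[OF r that] j(1,2) j1 by linarith
        qed
        then show ?thesis using r by (auto simp: enclosing_arcs_def)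
      qed
      then have "?e j = ?e i" by blast
      moreover have "j \<le> k \<and> k \<le> i" if "?e k = ?e i" for k
      proof -
        have "p \<in> ?e k" using pi that by simp
        then show ?thesis using q j lt by (auto simp: enclosing_arcs_def)
      qed
      ultimately have "cyclic_succ ?V i j" using j by (auto simp: cyclic_succ_def)
      then have "block_cycle ?\<pi> i = j" using cyclic_succ_unique[OF bc _ V(2)] by simp
      then show ?thesis using p q j by simp
    qed
  qed
  \<comment> \<open>One inclusion is enough, since both sides partition the same set.\<close>
  then have sub: "fatten n ?\<pi> \<subseteq> u" by (auto simp: fatten_def)
  have F: "partition_on {1..2 * n} (fatten n ?\<pi>)"
    using nc_pairingsD(1)[OF fatten_nc_pairing[OF unfatten_NC]] .
  have "u \<subseteq> fatten n ?\<pi>"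
  proof
    fix p assume p: "p \<in> u"
    then obtain x where x: "x \<in> p" using U(3)[OF p] by fastforce
    then have "x \<in> {1..2 * n}" using U(1) p by (auto simp: partition_on_def)
    then obtain q where "q \<in> fatten n ?\<pi>" "x \<in> q" using partition_on_mem[OF F] by blast
    then show "p \<in> fatten n ?\<pi>" using partition_on_unique[OF U(1) p] x sub by blast
  qed
  with sub show ?thesis by auto
qed

lemma bij_betw_fatten: "bij_betw (fatten n) (NC n) (nc_pairings {1..2 * n})"
  unfolding bij_betw_def
proof (intro conjI equalityI subsetI)
  show "inj_on (fatten n) (NC n)" by (rule inj_on_fatten)
  fix u assume "u \<in> nc_pairings {1..2 * n}"
  then show "u \<in> fatten n ` NC n" using fatten_unfatten unfatten_NC by (metis imageI)
next
  fix u assume "u \<in> fatten n ` NC n"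
  then show "u \<in> nc_pairings {1..2 * n}" using fatten_nc_pairing by blast
qed

text \<open>\<open>M\<close> follows the upper arcs from odd to even points and the lower arcs from
  even to odd points, so it traverses each arc once, in one direction. Under
  \<open>k = 2 * block_cycle \<pi> i - 1\<close> the inverse in its definition becomes
  \<open>M k = 2 * i\<close>.\<close>

lemma meandric_system_arcs:
  assumes \<pi>: "\<pi> \<in> NC n" and \<rho>: "\<rho> \<in> NC n"
  defines "M \<equiv> meandric_system n \<pi> \<rho>"
  shows "fatten n \<pi> = {{k, M k} |k. k \<in> {1..2 * n} \<and> odd k}"
    and "fatten n \<rho> = {{k, M k} |k. k \<in> {1..2 * n} \<and> even k}"
    and "\<And>k. k \<in> {1..2 * n} \<Longrightarrow> even (M k) \<longleftrightarrow> odd k"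
    and "\<And>k. k \<in> {1..2 * n} \<Longrightarrow> M k \<in> {1..2 * n}"
proof -
  let ?P = "block_cycle \<pi>" and ?R = "block_cycle \<rho>"
  have P: "?P permutes {1..n}" and R: "?R permutes {1..n}"
    using \<pi> \<rho> block_cycle_permutes unfolding NC_def by blast+
  have rR: "1 \<le> ?R i" "?R i \<le> n" if "i \<in> {1..n}" for i
    using permutes_in_image[OF R, of i] that by auto
  have rP: "1 \<le> ?P i" "?P i \<le> n" if "i \<in> {1..n}" for i
    using permutes_in_image[OF P, of i] that by auto
  have Modd: "M (2 * ?P i - 1) = 2 * i" if "i \<in> {1..n}" for i
  proof -
    have "2 * ?P i - 1 \<in> {1..2 * n}" "odd (2 * ?P i - 1)" "(2 * ?P i - 1 + 1) div 2 = ?P i"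
      using rP[OF that] by auto
    then show ?thesis using permutes_inverses(2)[OF P] by (simp add: M_def meandric_system_def)
  qed
  have Meven: "M (2 * i) = 2 * ?R i - 1" if "i \<in> {1..n}" for i
    using that by (simp add: M_def meandric_system_def)
  have odd: "\<exists>i\<in>{1..n}. k = 2 * ?P i - 1" if k: "k \<in> {1..2 * n}" "odd k" for k
  proof -
    obtain j where j: "k = 2 * j + 1" using k(2) by (rule oddE)
    then have "Suc j \<in> ?P ` {1..n}" using k permutes_image[OF P] by auto
    then obtain i where "i \<in> {1..n}" "?P i = Suc j" by auto
    then show ?thesis using j by (intro bexI[of _ i]) auto
  qed
  have even: "\<exists>i\<in>{1..n}. k = 2 * i" if k: "k \<in> {1..2 * n}" "even k" for k
  proof -
    obtain j where "k = 2 * j" using k(2) by (rule evenE)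
    then show ?thesis using k by auto
  qed
  show "fatten n \<pi> = {{k, M k} |k. k \<in> {1..2 * n} \<and> odd k}"
  proof (intro equalityI subsetI)
    fix p assume "p \<in> fatten n \<pi>"
    then obtain i where i: "i \<in> {1..n}" "p = {2 * i, 2 * ?P i - 1}" unfolding fatten_def by blast
    have "2 * ?P i - 1 \<in> {1..2 * n}" "odd (2 * ?P i - 1)" using rP[OF i(1)] by auto
    moreover have "p = {2 * ?P i - 1, M (2 * ?P i - 1)}" using Modd[OF i(1)] i(2) by auto
    ultimately show "p \<in> {{k, M k} |k. k \<in> {1..2 * n} \<and> odd k}" by blast
  next
    fix p assume "p \<in> {{k, M k} |k. k \<in> {1..2 * n} \<and> odd k}"
    then obtain k where k: "k \<in> {1..2 * n}" "odd k" "p = {k, M k}" by blast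
    then obtain i where i: "i \<in> {1..n}" "k = 2 * ?P i - 1" using odd by blast
    then have "p = {2 * i, 2 * ?P i - 1}" using k Modd by auto
    then show "p \<in> fatten n \<pi>" using i(1) unfolding fatten_def by blast
  qed
  show "fatten n \<rho> = {{k, M k} |k. k \<in> {1..2 * n} \<and> even k}"
  proof (intro equalityI subsetI)
    fix p assume "p \<in> fatten n \<rho>"
    then obtain i where i: "i \<in> {1..n}" "p = {2 * i, 2 * ?R i - 1}" unfolding fatten_def by blast
    have "2 * i \<in> {1..2 * n}" "even (2 * i)" using i(1) by auto
    moreover have "p = {2 * i, M (2 * i)}" using Meven[OF i(1)] i(2) by auto
    ultimately show "p \<in> {{k, M k} |k. k \<in> {1..2 * n} \<and> even k}" by blast
  next
    fix p assume "p \<in> {{k, M k} |k. k \<in> {1..2 * n} \<and> even k}"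
    then obtain k where k: "k \<in> {1..2 * n}" "even k" "p = {k, M k}" by blast
    then obtain i where i: "i \<in> {1..n}" "k = 2 * i" using even by blast
    then have "p = {2 * i, 2 * ?R i - 1}" using k Meven by auto
    then show "p \<in> fatten n \<rho>" using i(1) unfolding fatten_def by blast
  qed
  show "even (M k) \<longleftrightarrow> odd k" if k: "k \<in> {1..2 * n}" for k
  proof (cases "odd k")
    case True
    then obtain i where "i \<in> {1..n}" "k = 2 * ?P i - 1" using odd k by blast
    then show ?thesis using Modd True by auto
  next
    case False
    then obtain i where i: "i \<in> {1..n}" "k = 2 * i" using even k by blast
    have "odd (2 * ?R i - 1)" using rR[OF i(1)] by auto
    then show ?thesis using Meven[OF i(1)] i False by simp
  qed
  show "M k \<in> {1..2 * n}" if k: "k \<in> {1..2 * n}" for k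
  proof (cases "odd k")
    case True
    then obtain i where "i \<in> {1..n}" "k = 2 * ?P i - 1" using odd k by blast
    then show ?thesis using Modd by auto
  next
    case False
    then obtain i where i: "i \<in> {1..n}" "k = 2 * i" using even k by blast
    then show ?thesis using Meven[OF i(1)] rR[OF i(1)] by auto
  qed
qed

lemma inj_on_meandric_system:
  assumes \<pi>: "\<pi> \<in> NC n" and \<rho>: "\<rho> \<in> NC n"
  shows "inj_on (meandric_system n \<pi> \<rho>) {1..2 * n}"
proof (rule inj_onI)
  let ?M = "meandric_system n \<pi> \<rho>"
  note M = meandric_system_arcs[OF \<pi> \<rho>]
  fix x y assume xy: "x \<in> {1..2 * n}" "y \<in> {1..2 * n}" "?M x = ?M y"
  have par: "even x \<longleftrightarrow> even y" using M(3)[OF xy(1)] M(3)[OF xy(2)] xy(3) by simp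
  have "{x, ?M x} = {y, ?M y}"
  proof (cases "even x")
    case True
    then have "{x, ?M x} \<in> fatten n \<rho>" "{y, ?M y} \<in> fatten n \<rho>" using M(2) xy par by auto
    then show ?thesis
      by (rule partition_on_unique[OF nc_pairingsD(1)[OF fatten_nc_pairing[OF \<rho>]], of _ _ "?M x"])
        (use xy(3) in auto)
  next
    case False
    then have "{x, ?M x} \<in> fatten n \<pi>" "{y, ?M y} \<in> fatten n \<pi>" using M(1) xy par by auto
    then show ?thesis
      by (rule partition_on_unique[OF nc_pairingsD(1)[OF fatten_nc_pairing[OF \<pi>]], of _ _ "?M x"])
        (use xy(3) in auto)
  qed
  then show "x = y" using xy(3) M(3)[OF xy(1)] par by (auto simp: doubleton_eq_iff)
qed

text \<open>All arcs have the form \<open>{k, M k}\<close>, so saturation for both pairings says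
  that \<open>k\<close> and \<open>M k\<close> lie in \<open>J\<close> together. Injectivity of
  \<open>M\<close> on a finite set equates this with invariance of \<open>J\<close>.\<close>

lemma image_meandric_system_eq_iff:
  assumes \<pi>: "\<pi> \<in> NC n" and \<rho>: "\<rho> \<in> NC n" and J: "J \<subseteq> {1..2 * n}"
  shows "meandric_system n \<pi> \<rho> ` J = J \<longleftrightarrow> saturated (fatten n \<pi>) J \<and> saturated (fatten n \<rho>) J"
proof -
  let ?M = "meandric_system n \<pi> \<rho>"
  note M = meandric_system_arcs[OF \<pi> \<rho>] and inj = inj_on_meandric_system[OF \<pi> \<rho>]
  have arcs: "saturated {{k, ?M k} |k. k \<in> {1..2 * n} \<and> C k} J \<longleftrightarrow>
      (\<forall>k\<in>{1..2 * n}. C k \<longrightarrow> (k \<in> J \<longleftrightarrow> ?M k \<in> J))" for C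
  proof -
    have eq: "{{k, ?M k} |k. k \<in> {1..2 * n} \<and> C k} = (\<lambda>k. {k, ?M k}) ` {k \<in> {1..2 * n}. C k}"
      by blast
    show ?thesis unfolding eq saturated_def by auto
  qed
  have "saturated (fatten n \<pi>) J \<and> saturated (fatten n \<rho>) J \<longleftrightarrow>
      (\<forall>k\<in>{1..2 * n}. k \<in> J \<longleftrightarrow> ?M k \<in> J)"
    unfolding M(1,2) arcs by blast
  also have "\<dots> \<longleftrightarrow> ?M ` J = J"
  proof
    assume *: "\<forall>k\<in>{1..2 * n}. k \<in> J \<longleftrightarrow> ?M k \<in> J"
    then have "?M ` J \<subseteq> J" using J by blast
    then show "?M ` J = J"
      using inj J finite_subset[OF J] by (intro endo_inj_surj inj_on_subset[OF inj]) auto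
  next
    assume *: "?M ` J = J"
    show "\<forall>k\<in>{1..2 * n}. k \<in> J \<longleftrightarrow> ?M k \<in> J"
    proof
      fix k assume k: "k \<in> {1..2 * n}"
      show "k \<in> J \<longleftrightarrow> ?M k \<in> J"
        using inj_on_image_mem_iff[OF inj k J] * by simp
    qed
  qed
  finally show ?thesis by simp
qed

lemma reducible_meandric_iff:
  assumes \<pi>: "\<pi> \<in> NC n" and \<rho>: "\<rho> \<in> NC n"
  shows "reducible_meandric n \<pi> \<rho> \<longleftrightarrow> \<not> irreducible_pair {1..2 * n} (fatten n \<pi>) (fatten n \<rho>)"
proof
  assume "reducible_meandric n \<pi> \<rho>"
  then obtain a b where ab: "1 \<le> a" "a \<le> b" "b \<le> 2 * n" "b - a < 2 * n - 1"
    "meandric_system n \<pi> \<rho> ` {a..b} = {a..b}" unfolding reducible_meandric_def by blast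
  have sub: "{a..b} \<subseteq> {1..2 * n}" using ab by auto
  have "card {a..b} \<noteq> card {1..2 * n}" using ab by simp
  then have "{a..b} \<noteq> {1..2 * n}" by metis
  moreover have "interval_in {1..2 * n} {a..b}" using sub by (auto simp: interval_in_def)
  moreover have "{a..b} \<noteq> {}" using ab by simp
  ultimately show "\<not> irreducible_pair {1..2 * n} (fatten n \<pi>) (fatten n \<rho>)"
    using image_meandric_system_eq_iff[OF \<pi> \<rho> sub] ab(5) unfolding irreducible_pair_def by blast
next
  assume "\<not> irreducible_pair {1..2 * n} (fatten n \<pi>) (fatten n \<rho>)"
  then obtain J where J: "J \<noteq> {}" "J \<noteq> {1..2 * n}" "interval_in {1..2 * n} J"
    "saturated (fatten n \<pi>) J" "saturated (fatten n \<rho>) J" unfolding irreducible_pair_def by blast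
  have sub: "J \<subseteq> {1..2 * n}" using J(3) by (simp add: interval_in_def)
  then have fin: "finite J" by (rule finite_subset) simp
  have mm: "Min J \<in> J" "Max J \<in> J" using fin J(1) by auto
  have ge: "Min J \<le> k" "k \<le> Max J" if "k \<in> J" for k using fin that by auto
  have "{Min J..Max J} \<subseteq> J"
  proof
    fix k assume k: "k \<in> {Min J..Max J}"
    then have "k = Min J \<or> k = Max J \<or> Min J < k \<and> k < Max J" by auto
    moreover have "k \<in> {1..2 * n}" using k mm sub by (meson atLeastAtMost_iff le_trans subsetD)
    ultimately show "k \<in> J" using mm J(3) unfolding interval_in_def by blast
  qed
  then have eq: "{Min J..Max J} = J" using ge by auto
  have b: "1 \<le> Min J" "Max J \<le> 2 * n" "Min J \<le> Max J" using mm sub ge by auto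
  \<comment> \<open>The bound on \<open>b - a\<close> encodes properness: an interval of
    \<open>{1..2 * n}\<close> violates it only if it is everything.\<close>
  have "\<not> 2 * n - 1 \<le> Max J - Min J"
  proof
    assume "2 * n - 1 \<le> Max J - Min J"
    then have "Min J = 1" "Max J = 2 * n" using b by linarith+
    then show False using eq J(2) by simp
  qed
  moreover have "meandric_system n \<pi> \<rho> ` J = J"
    using image_meandric_system_eq_iff[OF \<pi> \<rho> sub] J by simp
  ultimately show "reducible_meandric n \<pi> \<rho>"
    unfolding reducible_meandric_def using b eq
    by (intro exI[of _ "Min J"] exI[of _ "Max J"]) simp
qed

lemma m_irr_eq_card_irr_pairs: "m_irr n = card (irr_pairs {1..2 * n})"
proof -
  let ?S = "{(\<pi>, \<rho>). \<pi> \<in> NC n \<and> \<rho> \<in> NC n \<and> \<not> reducible_meandric n \<pi> \<rho>}"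
  let ?F = "map_prod (fatten n) (fatten n)"
  have S: "?S = {x \<in> NC n \<times> NC n. case ?F x of (u, l) \<Rightarrow> irreducible_pair {1..2 * n} u l}"
    by (auto simp: reducible_meandric_iff)
  have img: "?F ` ?S = irr_pairs {1..2 * n}"
    unfolding S irr_pairs_def bij_betw_imp_surj_on[OF bij_betw_fatten, symmetric] by force
  have inj: "inj_on ?F ?S"
    by (rule inj_on_subset[OF map_prod_inj_on[OF inj_on_fatten inj_on_fatten]]) auto
  show ?thesis unfolding m_irr_def using card_image[OF inj] unfolding img by simp
qed

subsection \<open>Counting non-crossing pairings\<close>

text \<open>The arc at \<open>1\<close> cuts the remaining points into those under it and those to
  its right, and no other arc connects the two regions.\<close>

lemma card_nc_pairings_first_arc:
  fixes b m :: nat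
  assumes b: "1 < b" "b \<le> m"
  shows "card {u \<in> nc_pairings {1..m}. {1, b} \<in> u} =
    card (nc_pairings {1<..<b}) * card (nc_pairings {b<..m})"
proof -
  let ?I = "{1<..<b}" and ?O = "{b<..m}" and ?a = "{1, b}"
  let ?S = "{u \<in> nc_pairings {1..m}. ?a \<in> u}"
  define \<sigma> where "\<sigma> = {?a, ?I, ?O}"
  have \<sigma>: "disjoint \<sigma>" "non_crossing \<sigma>" "\<Union>\<sigma> = {1..m}"
  proof -
    show "disjoint \<sigma>" unfolding \<sigma>_def disjoint_def using b by auto
    show "non_crossing \<sigma>" unfolding \<sigma>_def non_crossing_def by auto
    show "\<Union>\<sigma> = {1..m}" unfolding \<sigma>_def using b by auto
  qed
  have ne: "?a \<noteq> ?I" "?a \<noteq> ?O" by auto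
  have single: "{?a} \<in> nc_pairings ?a"
    using b by (auto simp: nc_pairings_def partition_on_space non_crossing_def)
  let ?f = "\<lambda>u. (restr u ?I, restr u ?O)"
  let ?g = "\<lambda>(v, w). insert ?a (v \<union> w)"
  have g: "?g x \<in> ?S" "?f (?g x) = x" if x: "x \<in> nc_pairings ?I \<times> nc_pairings ?O" for x
  proof -
    obtain v w where vw: "x = (v, w)" "v \<in> nc_pairings ?I" "w \<in> nc_pairings ?O" using x by blast
    \<comment> \<open>For \<open>b = m = 2\<close> both regions are empty and coincide as elements
      of \<open>\<sigma>\<close>; \<open>h\<close> is still consistent because then \<open>v\<close>
      and \<open>w\<close> are both empty.\<close>
    define h where "h V = (if V = ?a then {?a} else if V = ?I then v else w)" for V
    have hO: "h ?O = w" "h ?I = v" "h ?a = {?a}"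
    proof -
      show "h ?a = {?a}" "h ?I = v" using ne by (simp_all add: h_def)
      show "h ?O = w"
      proof (cases "?O = ?I")
        case True
        moreover have "?I \<inter> ?O = {}" by auto
        ultimately have "?I = {}" "?O = {}" by auto
        then have "v = {}" "w = {}" using vw(2,3) nc_pairings_empty by simp_all
        then show ?thesis using ne by (simp add: h_def)
      qed (use ne in \<open>simp add: h_def\<close>)
    qed
    have h: "h V \<in> nc_pairings V" if "V \<in> \<sigma>" for V
    proof -
      have "V = ?a \<or> V = ?I \<or> V = ?O" using that by (simp add: \<sigma>_def)
      then show ?thesis using single vw(2,3) hO by metis
    qed
    have U: "(\<Union>V\<in>\<sigma>. h V) = ?g x" unfolding \<sigma>_def using hO vw(1) by auto
    show "?g x \<in> ?S" using Union_nc_pairings[OF \<sigma>(1,2) h] unfolding U \<sigma>(3) vw(1) by auto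
    show "?f (?g x) = x"
      using restr_Union[OF \<sigma>(1) h, of ?I] restr_Union[OF \<sigma>(1) h, of ?O]
      unfolding U using hO vw(1) by (auto simp: \<sigma>_def)
  qed
  have f: "subordinate u \<sigma>" if u: "u \<in> ?S" for u
    unfolding subordinate_def
  proof
    fix p assume p: "p \<in> u"
    have uu: "u \<in> nc_pairings {1..m}" "?a \<in> u" using u by auto
    note P = nc_pairingsD(1)[OF uu(1)]
    show "\<exists>V\<in>\<sigma>. p \<subseteq> V"
    proof (cases "p = ?a")
      case True then show ?thesis by (auto simp: \<sigma>_def)
    next
      case False
      have no: "1 \<notin> p" "b \<notin> p" using partition_on_unique[OF P p uu(2)] False by auto
      have pm: "p \<subseteq> {1..m}" using P p by (auto simp: partition_on_def)
      show ?thesis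
      proof (cases "p \<inter> ?I = {}")
        case True
        have "p \<subseteq> ?O"
        proof
          fix x assume x: "x \<in> p"
          then have "x \<noteq> 1" "x \<noteq> b" "x \<in> {1..m}" "x \<notin> ?I" using no pm True by auto
          then show "x \<in> ?O" by auto
        qed
        then show ?thesis by (auto simp: \<sigma>_def)
      next
        case F: False
        then obtain x where "x \<in> p" "1 < x" "x < b" by auto
        have "p \<subseteq> ?I"
        proof
          fix y assume "y \<in> p"
          from arc_no_crossing[OF uu(1,2) b(1) p False \<open>x \<in> p\<close> this \<open>1 < x\<close> \<open>x < b\<close>]
          show "y \<in> ?I" by simp
        qed
        then show ?thesis by (auto simp: \<sigma>_def)
      qed
    qed
  qed
  have bij: "bij_betw ?f ?S (nc_pairings ?I \<times> nc_pairings ?O)"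
  proof (rule bij_betwI[where g = ?g])
    show "?f \<in> ?S \<rightarrow> nc_pairings ?I \<times> nc_pairings ?O"
    proof
      fix u assume u: "u \<in> ?S"
      have "?I \<subseteq> {1..m}" "?O \<subseteq> {1..m}" using b by auto
      then have "restr u V \<in> nc_pairings V" if "V = ?I \<or> V = ?O" for V
        using that u by (intro restr_nc_pairing[OF _ f[OF u] \<sigma>(1), of "{1..m}"]) (auto simp: \<sigma>_def)
      then show "?f u \<in> nc_pairings ?I \<times> nc_pairings ?O" by blast
    qed
    show "?g (?f u) = u" if u: "u \<in> ?S" for u
    proof -
      have P: "partition_on {1..m} u" using u nc_pairingsD(1) by blast
      have "restr u ?a = {?a}"
      proof (intro equalityI subsetI)
        fix p assume p: "p \<in> restr u ?a"
        then have "p \<in> u" "p \<subseteq> ?a" by (auto simp: restr_def)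
        moreover have "p \<noteq> {}" using P \<open>p \<in> u\<close> by (auto simp: partition_on_def)
        ultimately obtain x where x: "x \<in> p" "x \<in> ?a" by blast
        then show "p \<in> {?a}"
          using partition_on_unique[OF P \<open>p \<in> u\<close> _ x] u by simp
      qed (use u in \<open>auto simp: restr_def\<close>)
      then show ?thesis using Union_restr[OF f[OF u]] by (auto simp: \<sigma>_def)
    qed
  qed (use g in auto)
  from bij_betw_same_card[OF bij] show ?thesis by (simp only: card_cartesian_product)
qed

text \<open>These are the Catalan numbers.\<close>

definition pairing_count :: "nat \<Rightarrow> nat" where
  "pairing_count n = card (nc_pairings {1..2 * n})"

lemma pairing_count_0: "pairing_count 0 = 1"
  by (simp add: pairing_count_def nc_pairings_empty)

text \<open>The partner of \<open>1\<close> is some \<open>2 * k + 2\<close> by parity; it leaves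
  \<open>2 * k\<close> points under the arc and \<open>2 * (n - k)\<close> to its right.\<close>

lemma pairing_count_Suc:
  "pairing_count (Suc n) = (\<Sum>k\<le>n. pairing_count k * pairing_count (n - k))"
proof -
  let ?m = "2 * Suc n"
  let ?S = "\<lambda>k. {u \<in> nc_pairings {1..?m}. {1, 2 * k + 2} \<in> u}"
  have "nc_pairings {1..?m} = (\<Union>k\<le>n. ?S k)"
  proof (intro equalityI subsetI)
    fix u assume u: "u \<in> nc_pairings {1..?m}"
    note U = nc_pairingsD[OF u]
    obtain p where p: "p \<in> u" "1 \<in> p" using partition_on_mem[OF U(1), of 1] by auto
    then obtain b where b: "p = {1, b}" "b \<noteq> 1" using U(3)[OF p(1)] by (auto simp: card_2_iff)
    have bm: "b \<in> {1..?m}" using U(1) p b by (auto simp: partition_on_def)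
    then have lt: "1 < b" using b by auto
    have "even (b - 1 - 1)" using p b by (intro arc_inside_even[OF u _ lt]) simp
    then obtain k where "b - 1 - 1 = 2 * k" by (rule evenE)
    then have "b = 2 * k + 2" "k \<le> n" using lt bm by auto
    then show "u \<in> (\<Union>k\<le>n. ?S k)" using u p b by auto
  qed auto
  then have "pairing_count (Suc n) = card (\<Union>k\<le>n. ?S k)" by (simp add: pairing_count_def)
  also have "\<dots> = (\<Sum>k\<le>n. card (?S k))"
  proof (rule card_UN_disjoint)
    show "\<forall>k\<in>{..n}. finite (?S k)"
      by (auto intro: finite_subset[OF _ finite_nc_pairings[of "{1..?m}"]])
    show "\<forall>k\<in>{..n}. \<forall>j\<in>{..n}. k \<noteq> j \<longrightarrow> ?S k \<inter> ?S j = {}"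
    proof (intro ballI impI, rule ccontr)
      fix k j :: nat assume kj: "k \<noteq> j" "?S k \<inter> ?S j \<noteq> {}"
      then obtain u where u: "u \<in> nc_pairings {1..?m}" "{1, 2 * k + 2} \<in> u" "{1, 2 * j + 2} \<in> u"
        by blast
      have "{1, 2 * k + 2} = {1, 2 * j + 2}"
        by (rule partition_on_unique[OF nc_pairingsD(1)[OF u(1)] u(2,3), of 1]) auto
      then show False using kj(1) by (auto simp: doubleton_eq_iff)
    qed
  qed simp
  also have "\<dots> = (\<Sum>k\<le>n. pairing_count k * pairing_count (n - k))"
  proof (rule sum.cong)
    fix k assume k: "k \<in> {..n}"
    have "card (?S k) = card (nc_pairings {1<..<2 * k + 2}) * card (nc_pairings {2 * k + 2<..?m})"
      using k by (intro card_nc_pairings_first_arc) auto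
    also have "card (nc_pairings {1<..<2 * k + 2}) = pairing_count k"
      by (subst card_nc_pairings_card) (auto simp: pairing_count_def)
    also have "card (nc_pairings {2 * k + 2<..?m}) = pairing_count (n - k)"
      by (subst card_nc_pairings_card) (auto simp: pairing_count_def diff_mult_distrib2)
    finally show "card (?S k) = pairing_count k * pairing_count (n - k)" .
  qed simp
  finally show ?thesis .
qed

text \<open>Puts the convolution recurrence into the first-order form that integration by parts
  yields for the even moments.\<close>

lemma pairing_count_recurrence:
  "(real n + 2) * real (pairing_count (Suc n)) = (4 * real n + 2) * real (pairing_count n)"
proof -
  define f :: "real fps" where "f = Abs_fps (\<lambda>n. real (pairing_count n))"
  have f: "f = 1 + fps_X * f\<^sup>2"
  proof (rule fps_ext)
    fix n show "fps_nth f n = fps_nth (1 + fps_X * f\<^sup>2) n"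
    proof (cases n)
      case (Suc m)
      have "fps_nth (f\<^sup>2) m = fps_nth f (Suc m)"
        by (simp add: power2_eq_square fps_mult_nth f_def pairing_count_Suc atLeast0AtMost)
      then show ?thesis using Suc by simp
    qed (simp add: f_def pairing_count_0)
  qed
  have d: "fps_deriv f = f\<^sup>2 + fps_X * (2 * f * fps_deriv f)"
    by (subst f) (simp add: power2_eq_square algebra_simps)
  \<comment> \<open>The generating function satisfies a linear differential equation because \<open>(1 - 2Xf)\<^sup>2 = 1 - 4X\<close>.\<close>
  have "(1 - 4 * fps_X) * (fps_X * fps_deriv f) = 1 - f + 2 * fps_X * f"
    using f d by algebra
  then have "fps_nth ((1 - 4 * fps_X) * (fps_X * fps_deriv f)) (Suc n) = fps_nth (1 - f + 2 * fps_X * f) (Suc n)"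
    by simp
  moreover have "fps_nth ((1 - 4 * fps_X) * (fps_X * fps_deriv f)) (Suc n) =
      real (Suc n) * fps_nth f (Suc n) - 4 * (real n * fps_nth f n)"
    by (cases n) (simp_all add: left_diff_distrib mult.assoc numeral_fps_const)
  moreover have "fps_nth (1 - f + 2 * fps_X * f) (Suc n) = 2 * fps_nth f n - fps_nth f (Suc n)"
    by (simp add: mult.assoc numeral_fps_const)
  ultimately show ?thesis by (simp add: f_def algebra_simps)
qed

subsection \<open>Semicircular moments\<close>

lemma semicircle_integral_recurrence:
  fixes k :: nat
  defines "I \<equiv> \<lambda>k. integral {-2..2} (\<lambda>t::real. t ^ k * sqrt (4 - t\<^sup>2))"
  shows "real (k + 4) * I (k + 2) = 4 * real (k + 1) * I k" and "I 1 = 0"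
proof -
  have integrable: "(\<lambda>t::real. t ^ k * sqrt (4 - t\<^sup>2)) integrable_on {-2..2}" for k
    by (intro integrable_continuous_real continuous_intros)
  have pos: "0 < 4 - t\<^sup>2" if "t \<in> {-2<..<2}" for t :: real
    using that abs_square_less_1[of "t / 2"] by (auto simp: power_divide)
  \<comment> \<open>Both claims come from integrating the derivative of \<open>t ^ j * (4 - t\<^sup>2) powr (3/2)\<close>, with \<open>j = k + 1\<close> and \<open>j = 0\<close>.\<close>
  have D: "((\<lambda>t. t ^ j * ((4 - t\<^sup>2) * sqrt (4 - t\<^sup>2))) has_vector_derivative
      real j * t ^ (j - 1) * ((4 - t\<^sup>2) * sqrt (4 - t\<^sup>2)) - 3 * (t ^ (j + 1) * sqrt (4 - t\<^sup>2))) (at t)"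
    if t: "t \<in> {-2<..<2}" for t :: real and j
  proof -
    have s: "(4 - t\<^sup>2) / sqrt (4 - t\<^sup>2) = sqrt (4 - t\<^sup>2)" using pos[OF t] by (simp add: real_div_sqrt)
    have "((\<lambda>t. t ^ j * ((4 - t\<^sup>2) * sqrt (4 - t\<^sup>2))) has_real_derivative
      real j * t ^ (j - 1) * ((4 - t\<^sup>2) * sqrt (4 - t\<^sup>2)) +
      t ^ j * (- 2 * t * sqrt (4 - t\<^sup>2) - t * ((4 - t\<^sup>2) / sqrt (4 - t\<^sup>2)))) (at t)"
      using pos[OF t] by (auto intro!: derivative_eq_intros simp: field_simps)
    then show ?thesis unfolding s by (simp add: has_real_derivative_iff_has_vector_derivative algebra_simps)
  qed
  \<comment> \<open>The boundary terms vanish with \<open>4 - t\<^sup>2\<close>. The interior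
    version of the fundamental theorem is used because the derivative of the square root is taken
    only where \<open>4 - t\<^sup>2\<close> is positive. For \<open>j = 0\<close> the truncated
    exponent \<open>j - 1\<close> is harmless due to the factor \<open>real j\<close>.\<close>
  have FTC: "((\<lambda>t. real j * t ^ (j - 1) * ((4 - t\<^sup>2) * sqrt (4 - t\<^sup>2)) - 3 * (t ^ (j + 1) * sqrt (4 - t\<^sup>2)))
      has_integral 0) {-2..2::real}" for j
  proof -
    have "continuous_on {-2..2::real} (\<lambda>t. t ^ j * ((4 - t\<^sup>2) * sqrt (4 - t\<^sup>2)))"
      by (intro continuous_intros)
    from fundamental_theorem_of_calculus_interior[OF _ this D] show ?thesis by simp
  qed
  have a1: "((\<lambda>t. (-3) * (t ^ 1 * sqrt (4 - t\<^sup>2))) has_integral 0) {-2..2::real}"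
    using FTC[of 0] by simp
  have a2: "((\<lambda>t. (-3) * (t ^ 1 * sqrt (4 - t\<^sup>2))) has_integral (-3) * I 1) {-2..2::real}"
    unfolding I_def using integrable by (intro has_integral_mult_right integrable_integral)
  from has_integral_unique[OF a1 a2] show "I 1 = 0" by simp
  \<comment> \<open>Expanding the factor \<open>4 - t\<^sup>2\<close> merges its
    \<open>t\<^sup>2\<close> part with the last term; the coefficient is
    \<open>(k + 1) + 3\<close>.\<close>
  have b1: "((\<lambda>t. 4 * real (k + 1) * (t ^ k * sqrt (4 - t\<^sup>2)) - real (k + 4) * (t ^ (k + 2) * sqrt (4 - t\<^sup>2)))
      has_integral 0) {-2..2::real}"
    using FTC[of "k + 1"] by (simp add: algebra_simps power2_eq_square)
  have b2: "((\<lambda>t. 4 * real (k + 1) * (t ^ k * sqrt (4 - t\<^sup>2)) - real (k + 4) * (t ^ (k + 2) * sqrt (4 - t\<^sup>2)))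
      has_integral (4 * real (k + 1) * I k - real (k + 4) * I (k + 2))) {-2..2::real}"
    unfolding I_def using integrable
    by (intro has_integral_diff has_integral_mult_right integrable_integral)
  from has_integral_unique[OF b1 b2] show "real (k + 4) * I (k + 2) = 4 * real (k + 1) * I k"
    by simp
qed

lemma semicircle_density_nonneg: "0 \<le> semicircle_density t"
  using abs_le_square_iff[of t 2] by (auto simp: semicircle_density_def indicator_def)

lemma integrable_power_semicircle:
  "integrable lborel (\<lambda>t. semicircle_density t * t ^ k)"
  and integral_power_semicircle:
  "integral\<^sup>L lborel (\<lambda>t. semicircle_density t * t ^ k) =
    integral {-2..2} (\<lambda>t. t ^ k * sqrt (4 - t\<^sup>2)) / (2 * pi)"
proof -
  let ?g = "\<lambda>t::real. t ^ k * sqrt (4 - t\<^sup>2)"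
  have eq: "(\<lambda>t. semicircle_density t * t ^ k) = (\<lambda>t. (indicator {-2..2} t *\<^sub>R ?g t) / (2 * pi))"
    by (auto simp: semicircle_density_def)
  have "set_integrable lborel {-2..2} ?g"
    by (intro borel_integrable_atLeastAtMost' continuous_intros)
  then show "integrable lborel (\<lambda>t. semicircle_density t * t ^ k)"
      "integral\<^sup>L lborel (\<lambda>t. semicircle_density t * t ^ k) = integral {-2..2} ?g / (2 * pi)"
    using set_borel_integral_eq_integral(2)[of "{-2..2}" ?g]
    unfolding eq set_integrable_def set_lebesgue_integral_def by auto
qed

context prob_space
begin

lemma semicircle_integrable_power:
  assumes "distributed M lborel \<xi> (\<lambda>t. ennreal (semicircle_density t))"
  shows "integrable M (\<lambda>\<omega>. \<xi> \<omega> ^ k)"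
  using distributed_integrable[OF assms, of "\<lambda>t. t ^ k"] integrable_power_semicircle[of k]
  by (simp add: semicircle_density_nonneg)

text \<open>One recurrence with step two serves both parities: it starts from total mass one for the
  even moments and from \<open>m 1 = 0\<close> for the odd ones.\<close>

lemma semicircle_moments:
  assumes \<xi>: "distributed M lborel \<xi> (\<lambda>t. ennreal (semicircle_density t))"
  shows "expectation (\<lambda>\<omega>. \<xi> \<omega> ^ (2 * n)) = real (pairing_count n)"
    and "expectation (\<lambda>\<omega>. \<xi> \<omega> ^ (2 * n + 1)) = 0"
proof -
  define m where "m k = expectation (\<lambda>\<omega>. \<xi> \<omega> ^ k)" for k
  define I where "I k = integral {-2..2} (\<lambda>t::real. t ^ k * sqrt (4 - t\<^sup>2))" for k
  have mI: "m k = I k / (2 * pi)" for k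
    using distributed_integral[OF \<xi>, of "\<lambda>t. t ^ k"] integral_power_semicircle[of k]
    by (simp add: semicircle_density_nonneg m_def I_def)
  have m1: "m 1 = 0" using semicircle_integral_recurrence(2) by (simp add: mI I_def)
  have rec: "real (k + 4) * m (k + 2) = 4 * real (k + 1) * m k" for k
    using semicircle_integral_recurrence(1)[of k] by (simp add: mI I_def)
  have m0: "m 0 = 1" by (simp add: m_def prob_space)
  have "m (2 * n) = real (pairing_count n)"
  proof (induction n)
    case 0 then show ?case by (simp add: m0 pairing_count_0)
  next
    case (Suc n)
    have "(2 * real n + 4) * m (2 * Suc n) = (2 * real n + 4) * real (pairing_count (Suc n))"
      using rec[of "2 * n"] pairing_count_recurrence[of n] Suc by (simp add: algebra_simps)
    then show ?case by (simp add: add_eq_0_iff)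
  qed
  then show "expectation (\<lambda>\<omega>. \<xi> \<omega> ^ (2 * n)) = real (pairing_count n)" by (simp add: m_def)
  have "m (2 * n + 1) = 0"
  proof (induction n)
    case 0 then show ?case using m1 by simp
  next
    case (Suc n)
    have "real (2 * n + 1 + 4) * m (2 * n + 1 + 2) = 0" using rec[of "2 * n + 1"] Suc by simp
    then have "m (2 * n + 1 + 2) = 0" by (simp del: of_nat_add)
    then show ?case by (simp add: algebra_simps)
  qed
  then show "expectation (\<lambda>\<omega>. \<xi> \<omega> ^ (2 * n + 1)) = 0" by (simp add: m_def)
qed

text \<open>Independence factors the moment into two equal semicircular moments. For odd
  \<open>k\<close> both sides are zero, as an odd number of points has no pairing.\<close>

lemma product_moments:
  assumes \<xi>: "distributed M lborel \<xi> (\<lambda>t. ennreal (semicircle_density t))"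
    and \<eta>: "distributed M lborel \<eta> (\<lambda>t. ennreal (semicircle_density t))"
    and ind: "indep_var borel \<xi> borel \<eta>"
  shows "expectation (\<lambda>\<omega>. (\<xi> \<omega> * \<eta> \<omega>) ^ k) = (real (card (nc_pairings {1..k})))\<^sup>2"
proof -
  have "indep_var borel ((\<lambda>t. t ^ k) \<circ> \<xi>) borel ((\<lambda>t. t ^ k) \<circ> \<eta>)"
    by (rule indep_var_compose[OF ind]) auto
  then have "expectation (\<lambda>\<omega>. (\<xi> \<omega> * \<eta> \<omega>) ^ k) =
      expectation (\<lambda>\<omega>. \<xi> \<omega> ^ k) * expectation (\<lambda>\<omega>. \<eta> \<omega> ^ k)"
    using indep_var_lebesgue_integral[of "\<lambda>\<omega>. \<xi> \<omega> ^ k" "\<lambda>\<omega>. \<eta> \<omega> ^ k"]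
      semicircle_integrable_power[OF \<xi>] semicircle_integrable_power[OF \<eta>]
    by (simp add: power_mult_distrib comp_def)
  also have "\<dots> = (real (card (nc_pairings {1..k})))\<^sup>2"
  proof (cases "even k")
    case True
    then obtain n where "k = 2 * n" by (rule evenE)
    then show ?thesis using semicircle_moments(1)[OF \<xi>] semicircle_moments(1)[OF \<eta>]
      by (simp add: pairing_count_def power2_eq_square)
  next
    case False
    then obtain n where n: "k = 2 * n + 1" by (rule oddE)
    have "nc_pairings {1..k} = {}" using nc_pairing_even_card[of "{1..k}"] False by auto
    then show ?thesis using semicircle_moments(2)[OF \<xi>] n by simp
  qed
  finally show ?thesis .
qed

end

subsection \<open>The free cumulants of the product\<close>

theorem theorem1p2:
  fixes P :: "'a measure" and \<xi> \<eta> :: "'a \<Rightarrow> real"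
  assumes "prob_space P"
    and "distributed P lborel \<xi> (\<lambda>t. ennreal (semicircle_density t))"
    and "distributed P lborel \<eta> (\<lambda>t. ennreal (semicircle_density t))"
    and "prob_space.indep_var P borel \<xi> borel \<eta>"
  shows "f_irr = R_transform (moment_functional P (\<lambda>\<omega>. \<xi> \<omega> * \<eta> \<omega>)) \<and>
    (\<forall>n\<ge>1. free_cumulant (moment_functional P (\<lambda>\<omega>. \<xi> \<omega> * \<eta> \<omega>)) (2 * n - 1) = 0 \<and>
            free_cumulant (moment_functional P (\<lambda>\<omega>. \<xi> \<omega> * \<eta> \<omega>)) (2 * n) = of_nat (m_irr n))"
proof -
  let ?\<mu> = "moment_functional P (\<lambda>\<omega>. \<xi> \<omega> * \<eta> \<omega>)"
  \<comment> \<open>On the empty set the pair of empty pairings is irreducible, so the count there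
    is one, whereas the convention for cumulants puts zero at index \<open>0\<close>.\<close>
  define \<kappa> :: "nat \<Rightarrow> complex" where "\<kappa> k = (if k = 0 then 0 else of_nat (card (irr_pairs {1..k})))" for k
  have "?\<mu> (monom 1 n) = (\<Sum>\<pi>\<in>NC n. \<Prod>V\<in>\<pi>. \<kappa> (card V))" if n: "n \<ge> 1" for n
  proof -
    have \<kappa>: "\<kappa> (card V) = of_nat (card (irr_pairs V))" if "\<pi> \<in> NC n" "V \<in> \<pi>" for \<pi> V
    proof -
      have V: "V \<subseteq> {1..n}" "V \<noteq> {}" using that by (auto simp: NC_def partition_on_def)
      then have "finite V" by (auto intro: finite_subset)
      then show ?thesis using V card_irr_pairs_card[of V] by (simp add: \<kappa>_def)
    qed
    have "(\<Sum>\<pi>\<in>NC n. \<Prod>V\<in>\<pi>. \<kappa> (card V)) = of_nat (\<Sum>\<pi>\<in>NC n. \<Prod>V\<in>\<pi>. card (irr_pairs V))"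
      unfolding of_nat_sum of_nat_prod by (intro sum.cong prod.cong refl \<kappa>)
    also have "\<dots> = of_nat ((card (nc_pairings {1..n}))\<^sup>2)" by (simp only: sum_NC_irr_pairs[OF n])
    also have "\<dots> = ?\<mu> (monom 1 n)"
      unfolding moment_functional_monom prob_space.product_moments[OF assms] by simp
    finally show ?thesis by simp
  qed
  \<comment> \<open>\<open>\<kappa>\<close> solves the moment-cumulant equations for these moments,
    hence it is their unique solution.\<close>
  then have c: "free_cumulant ?\<mu> = \<kappa>"
    unfolding free_cumulant_def
    by (intro the1_equality[OF free_cumulants_ex1]) (simp add: \<kappa>_def)
  have odd: "\<kappa> k = 0" if "odd k" for k
  proof -
    have "nc_pairings {1..k} = {}" using nc_pairing_even_card[of "{1..k}"] that by auto
    then show ?thesis by (simp add: \<kappa>_def irr_pairs_def)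
  qed
  have even: "\<kappa> (2 * n) = of_nat (m_irr n)" if "n \<ge> 1" for n
    using that by (simp add: \<kappa>_def m_irr_eq_card_irr_pairs)
  have "f_irr = R_transform ?\<mu>"
  proof (rule fps_ext)
    fix k show "fps_nth f_irr k = fps_nth (R_transform ?\<mu>) k"
      using odd[of k] even[of "k div 2"] by (auto simp: f_irr_def R_transform_def c \<kappa>_def)
  qed
  then show ?thesis using odd even c by auto
qed

end
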